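(* Let $k\ge 1$, let $G=(V,E)$ be a directed graph with $n$ vertices and let $\mathcal{P}\subseteq V\times V$ be a set of vertex pairs with $|\mathcal{P}|=\omega(k\,n^{1-\frac1k}\log n)$. Then there exists a $k$-fault-tolerant reachability subgraph of $G$ for $\mathcal{P}$ having only $o(2^k n|\mathcal{P}|)$ edges.
   Context: A subgraph $H$ of $G=(V,E)$ is a $k$-fault-tolerant reachability subgraph of $G$ for $\mathcal{P}$ if for every pair $(s,t)\in\mathcal{P}$ and every set $F\subseteq E$ of at most $k$ edges, $t$ is reachable from $s$ in $G\setminus F$ if and only if $t$ is reachable from $s$ in $H\setminus F$. *)

theory Defs
  imports Complex_Main "HOL-Library.Landau_Symbols" "Graph_Theory.Graph_Theory"
begin

definition delete_arcs :: "'a pair_pre_digraph \<Rightarrow> ('a \<times> 'a) set \<Rightarrow> 'a pair_pre_digraph" where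
  "delete_arcs G F = \<lparr> pverts = pverts G, parcs = parcs G - F \<rparr>"

text \<open>
  The fault set ranges over edges of \<open>G\<close>; it need not be contained in \<open>H\<close>. Library reachability
  is restricted to the vertex set, so a vertex outside \<open>H\<close> is not even reachable from itself in \<open>H\<close>.
\<close>

definition ft_reachability_subgraph ::
  "nat \<Rightarrow> 'a pair_pre_digraph \<Rightarrow> ('a \<times> 'a) set \<Rightarrow> 'a pair_pre_digraph \<Rightarrow> bool" where
  "ft_reachability_subgraph k G P H \<longleftrightarrow>
     subgraph (with_proj H) (with_proj G) \<and>
     (\<forall>(s, t) \<in> P. \<forall>F. F \<subseteq> parcs G \<and> finite F \<and> card F \<le> k \<longrightarrow>
        (s \<rightarrow>\<^sup>*\<^bsub>with_proj (delete_arcs G F)\<^esub> t \<longleftrightarrow> s \<rightarrow>\<^sup>*\<^bsub>with_proj (delete_arcs H F)\<^esub> t))"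

end

(*
  Call r good for the pair (s,t) and the fault set F if s -> r -> t survives in G - F. A greedy
  hitting set R of O(k (n/c) log n) vertices contains a good vertex whenever more than c vertices
  are good.
  Faults with a good vertex in R are handled by k-fault-tolerant preservers from and to every
  r in R, of 2^(k+1) n arcs each (Baswana, Choudhary and Roditty). For the remaining faults all
  s-t paths live on at most c vertices, and branching over the arcs of short replacement paths
  costs O(c)^k arcs per pair: the last fault costs only a factor O(c), because once a vertex r
  survives k - 1 faults, one path avoiding the first s-r separator and one avoiding the last r-t
  separator suffice. With c a small constant times n^(1/k) both contributions are small; if this c
  is below 1, then n is small compared with the number of pairs, and G itself is sparse enough.
*)
theory Submission
  imports Defs
begin

section \<open>Cuts\<close>

text \<open>Branching with a replacement path at each of \<open>k + 1\<close> levels would cost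
  O(c)^(k+1) arcs per pair. Then c could only be about n^(1/(k+1)), and the hitting set would be too
  large for the assumed number of pairs. The separator argument saves the one factor that allows
  n^(1/k). The logarithm and the factor k in front of it come from the hitting set, which faces
  n^O(k) vertex sets, one per pair and fault set. All preservers rest on farthest minimum cuts. A
  cut around the source is enlarged in \<open>k + 1\<close> stages; each stage at most doubles its
  size, provided out-degrees are at most two, and gains one unit of connectivity against the faults.
  Hence \<open>2 ^ (k + 1)\<close> arcs per vertex suffice. With no faults this means two arcs per
  vertex, and such a preserver, confined to the vertices between s and t, takes the place of a short
  path.\<close>

definition out :: "('a \<times> 'a) set \<Rightarrow> 'a set \<Rightarrow> ('a \<times> 'a) set" where
  "out E A = {(x, y) \<in> E. x \<in> A \<and> y \<notin> A}"

lemma out_subset: "out E A \<subseteq> E"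
  by (auto simp: out_def)

lemma out_mono: "E \<subseteq> E' \<Longrightarrow> out E A \<subseteq> out E' A"
  by (auto simp: out_def)

lemma finite_out: "finite E \<Longrightarrow> finite (out E A)"
  using finite_subset[OF out_subset] .

text \<open>An arc leaving the union or the intersection leaves \<open>A\<close> or
  \<open>B\<close>, and an arc leaving both union and intersection leaves both. This is the
  uncrossing inequality behind all later cut arguments.\<close>

lemma card_out_submodular:
  assumes "finite E"
  shows "card (out E (A \<union> B)) + card (out E (A \<inter> B)) \<le> card (out E A) + card (out E B)"
proof -
  note fin = finite_out[OF assms]
  have "card (out E (A \<union> B)) + card (out E (A \<inter> B)) =
      card (out E (A \<union> B) \<union> out E (A \<inter> B)) + card (out E (A \<union> B) \<inter> out E (A \<inter> B))"
    using card_Un_Int fin by blast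
  also have "\<dots> \<le> card (out E A \<union> out E B) + card (out E A \<inter> out E B)"
    by (intro add_mono card_mono) (use fin in \<open>auto simp: out_def\<close>)
  also have "\<dots> = card (out E A) + card (out E B)"
    using card_Un_Int fin by metis
  finally show ?thesis .
qed

lemma rtrancl_leaves:
  assumes "(s, t) \<in> E\<^sup>*" "s \<in> A" "t \<notin> A"
  shows "out E A \<noteq> {}"
  using assms by (induction rule: rtrancl_induct) (auto simp: out_def)

lemma rtrancl_closed:
  assumes "(s, x) \<in> E\<^sup>*" "s \<in> A" "out E A = {}"
  shows "x \<in> A"
  using rtrancl_leaves assms by metis

text \<open>This is the minimum cut of Ford and Fulkerson with the largest source side;
  \<open>U\<close> is usually everything but the target. The strict inequality in the last clause is
  what yields an extra unit when a set reaching beyond \<open>A\<close> is uncrossed with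
  \<open>A\<close>.\<close>

definition farthest_cut :: "('a \<times> 'a) set \<Rightarrow> 'a set \<Rightarrow> 'a set \<Rightarrow> 'a set \<Rightarrow> bool" where
  "farthest_cut E U S A \<longleftrightarrow> S \<subseteq> A \<and> A \<subseteq> U \<and>
     (\<forall>C. S \<subseteq> C \<and> C \<subseteq> U \<longrightarrow> card (out E A) \<le> card (out E C)) \<and>
     (\<forall>C. A \<subset> C \<and> C \<subseteq> U \<longrightarrow> card (out E A) < card (out E C))"

lemma farthest_cut_exists:
  assumes "finite U" "S \<subseteq> U"
  obtains A where "farthest_cut E U S A"
proof -
  define T where "T = {A. S \<subseteq> A \<and> A \<subseteq> U \<and>
     (\<forall>C. S \<subseteq> C \<and> C \<subseteq> U \<longrightarrow> card (out E A) \<le> card (out E C))}"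
  have "S \<subseteq> S \<and> S \<subseteq> U" using assms by simp
  from ex_has_least_nat[of "\<lambda>A. S \<subseteq> A \<and> A \<subseteq> U", OF this, of "\<lambda>A. card (out E A)"]
  have "T \<noteq> {}" unfolding T_def by blast
  moreover have "finite T"
    by (rule finite_subset[of _ "Pow U"]) (use assms in \<open>auto simp: T_def\<close>)
  ultimately obtain A where A: "A \<in> T" "\<And>C. C \<in> T \<Longrightarrow> \<not> A \<subset> C"
    using finite_has_maximal[of T] by (metis psubsetE psubset_imp_subset)
  have "card (out E A) < card (out E C)" if "A \<subset> C" "C \<subseteq> U" for C
  proof (rule ccontr)
    assume "\<not> ?thesis"
    then have le: "card (out E C) \<le> card (out E A)" by simp
    have "S \<subseteq> C" using A(1) that by (auto simp: T_def)
    moreover have "card (out E C) \<le> card (out E D)" if "S \<subseteq> D" "D \<subseteq> U" for D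
      using A(1) that le by (auto simp: T_def intro: order_trans)
    ultimately have "C \<in> T" using that by (simp add: T_def)
    with A(2) that show False by blast
  qed
  with A(1) have "farthest_cut E U S A" unfolding farthest_cut_def T_def by blast
  then show thesis by (rule that)
qed

section \<open>Thinning out the arcs into one vertex\<close>

definition into :: "('a \<times> 'a) set \<Rightarrow> 'a \<Rightarrow> ('a \<times> 'a) set" where
  "into E t = {e \<in> E. snd e = t}"

text \<open>
  \<open>D\<close> is minimal among the sets of arcs into \<open>t\<close> that keep the value of the cuts around \<open>S\<close>. Every arc
  of \<open>D\<close> then leaves a tight cut, and by uncrossing all of them leave one common tight cut.
\<close>

lemma few_arcs_into:
  assumes "finite E" "finite V" and A: "farthest_cut E (V - {t}) S A"
  obtains D where "D \<subseteq> into E t" "card D \<le> card (out E A)"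
    "\<And>x. x \<in> A \<Longrightarrow> (x, t) \<in> E \<Longrightarrow> (x, t) \<in> D"
    "\<And>C. C \<subseteq> V - {t} \<Longrightarrow> card (out E (C \<inter> A)) \<le> card (out ((E - into E t) \<union> D) C)"
proof -
  define U where "U = V - {t}"
  define G where "G D = (E - into E t) \<union> D" for D
  define Q where "Q D \<longleftrightarrow> D \<subseteq> into E t \<and>
    (\<forall>C. S \<subseteq> C \<and> C \<subseteq> U \<longrightarrow> card (out E A) \<le> card (out (G D) C))" for D
  have fI: "finite (into E t)" using assms(1) by (auto simp: into_def)
  have SA: "S \<subseteq> A" "A \<subseteq> U" and Amin: "\<And>C. S \<subseteq> C \<Longrightarrow> C \<subseteq> U \<Longrightarrow> card (out E A) \<le> card (out E C)"
    using A unfolding farthest_cut_def U_def by auto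
  have "G (into E t) = E" by (auto simp: G_def into_def)
  then have "Q (into E t)" using Amin by (auto simp: Q_def)
  from ex_has_least_nat[of Q, OF this, of card]
  obtain D where D: "Q D" and Dmin: "\<And>D'. Q D' \<Longrightarrow> card D \<le> card D'" by blast
  have DI: "D \<subseteq> into E t"
    and Dcut: "\<And>C. S \<subseteq> C \<Longrightarrow> C \<subseteq> U \<Longrightarrow> card (out E A) \<le> card (out (G D) C)"
    using D by (auto simp: Q_def)
  have GE: "G D \<subseteq> E" using DI by (auto simp: G_def into_def)
  have fG: "finite (G D)" using GE assms(1) finite_subset by blast
  have fD: "finite D" using DI fI finite_subset by blast
  \<comment> \<open>The cut of \<open>A\<close> has minimum value already in \<open>E\<close>, so
    keeping that value means losing none of its arcs. In particular every arc from \<open>A\<close>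
    to \<open>t\<close> lies in \<open>D\<close>.\<close>
  have AA: "out (G D) A = out E A"
    using card_seteq[OF finite_out[OF assms(1)] out_mono[OF GE]] Dcut SA by blast
  have tA: "t \<notin> A" using SA(2) by (auto simp: U_def)
  have into_D: "(x, t) \<in> D" if "x \<in> A" "(x, t) \<in> E" for x
  proof -
    have "(x, t) \<in> out (G D) A" unfolding AA using that tA by (auto simp: out_def)
    then show ?thesis by (auto simp: out_def G_def into_def)
  qed
  \<comment> \<open>The cut of \<open>C \<inter> A\<close> is untouched, because its arcs into
    \<open>t\<close> start in \<open>A\<close>. Uncrossing with the tight set \<open>A\<close>
    carries its value over to \<open>C\<close>, which need not contain \<open>S\<close>.\<close>
  have cut: "card (out E (C \<inter> A)) \<le> card (out (G D) C)" if "C \<subseteq> U" for C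
  proof -
    have "out E (C \<inter> A) \<subseteq> out (G D) (C \<inter> A)"
      using into_D by (auto simp: out_def G_def into_def)
    then have "card (out E (C \<inter> A)) \<le> card (out (G D) (C \<inter> A))"
      by (intro card_mono finite_out fG)
    moreover have "card (out (G D) A) \<le> card (out (G D) (C \<union> A))"
      unfolding AA using SA that by (intro Dcut) auto
    ultimately show ?thesis using card_out_submodular[OF fG, of C A] by linarith
  qed
  \<comment> \<open>The farthest minimum cut of the thinned graph absorbs every tight cut, so it is
    the common one.\<close>
  obtain B where B: "farthest_cut (G D) U S B"
    using farthest_cut_exists[of U S "G D"] assms(2) SA by (auto simp: U_def)
  have SB: "S \<subseteq> B" "B \<subseteq> U" and Bmin: "\<And>C. S \<subseteq> C \<Longrightarrow> C \<subseteq> U \<Longrightarrow> card (out (G D) B) \<le> card (out (G D) C)"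
    and Bmax: "\<And>C. B \<subset> C \<Longrightarrow> C \<subseteq> U \<Longrightarrow> card (out (G D) B) < card (out (G D) C)"
    using B unfolding farthest_cut_def by auto
  have cB: "card (out (G D) B) = card (out E A)"
    using Bmin[OF SA] Dcut[OF SB] AA by simp
  have "D \<subseteq> out (G D) B"
  proof
    fix e assume e: "e \<in> D"
    \<comment> \<open>Dropping \<open>e\<close> pushes some cut \<open>C\<close> below the required
      value; with \<open>e\<close> put back \<open>C\<close> is tight and \<open>e\<close> leaves
      it. Then \<open>C \<union> B\<close> is tight too, which forces
      \<open>C \<subseteq> B\<close>.\<close>
    have "\<not> Q (D - {e})" using Dmin[of "D - {e}"] card_Diff1_less[OF fD e] by linarith
    then obtain C where C: "S \<subseteq> C" "C \<subseteq> U" and less: "card (out (G (D - {e})) C) < card (out E A)"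
      using DI unfolding Q_def by (auto simp: not_le)
    have sub: "out (G D) C \<subseteq> insert e (out (G (D - {e})) C)"
      by (auto simp: out_def G_def)
    have fG': "finite (out (G (D - {e})) C)"
      by (rule finite_out) (use assms(1) fD in \<open>auto simp: G_def\<close>)
    have "card (out (G D) C) \<le> card (insert e (out (G (D - {e})) C))"
      using sub fG' by (intro card_mono) auto
    then have cC: "card (out (G D) C) \<le> card (out E A)"
      using less fG' by (simp add: card_insert_if split: if_splits)
    have eC: "e \<in> out (G D) C"
    proof (rule ccontr)
      assume "e \<notin> out (G D) C"
      then have "out (G D) C \<subseteq> out (G (D - {e})) C" using sub by blast
      then have "card (out (G D) C) \<le> card (out (G (D - {e})) C)" using fG' card_mono by blast
      then show False using less Dcut[OF C] by linarith
    qed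
    have "card (out E A) \<le> card (out (G D) (C \<inter> B))" using C SB by (intro Dcut) auto
    then have "card (out (G D) (C \<union> B)) \<le> card (out (G D) B)"
      using card_out_submodular[OF fG, of C B] cC cB by linarith
    then have "C \<subseteq> B" using Bmax[of "C \<union> B"] C SB by fastforce
    moreover have "snd e = t" using e DI by (auto simp: into_def)
    ultimately show "e \<in> out (G D) B"
      using eC e SB by (auto simp: out_def U_def)
  qed
  then have "card D \<le> card (out E A)" using card_mono finite_out[OF fG] cB by metis
  then show thesis using that[of D] DI into_D cut unfolding G_def U_def by blast
qed

text \<open>Every arc of the new cut is charged to an arc of the old one: an arc from
  \<open>A\<close> to \<open>t\<close> to itself, any other arc to an old cut arc that ends in its
  tail. By the degree bound no old arc is charged more than twice.\<close>

lemma card_out_successors: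
  assumes "finite E" and deg: "\<And>v. card (E `` {v}) \<le> 2" and t: "t \<notin> A"
  shows "card (out E ((A \<union> E `` A) - {t})) \<le> 2 * card (out E A)"
proof -
  define f where "f = (\<lambda>(x, y). if y = t then {(x, t)} else {y} \<times> (E `` {y}))"
  have fin: "finite (E `` {v})" for v using assms(1) by auto
  have "out E ((A \<union> E `` A) - {t}) \<subseteq> (\<Union>e\<in>out E A. f e)"
  proof
    fix e assume "e \<in> out E ((A \<union> E `` A) - {t})"
    then obtain y z where e: "e = (y, z)" "(y, z) \<in> E" "y \<in> A \<union> E `` A" "y \<noteq> t"
      "z \<notin> (A \<union> E `` A) - {t}" by (auto simp: out_def)
    show "e \<in> (\<Union>e\<in>out E A. f e)"
    proof (cases "y \<in> A")
      case True
      then have "z = t" using e by blast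
      then have "(y, z) \<in> out E A" using True t e by (auto simp: out_def)
      then show ?thesis using e \<open>z = t\<close> by (auto simp: f_def intro!: bexI[of _ "(y, z)"])
    next
      case False
      then obtain x where "x \<in> A" "(x, y) \<in> E" using e by blast
      then have "(x, y) \<in> out E A" using False by (auto simp: out_def)
      then show ?thesis using e by (auto simp: f_def intro!: bexI[of _ "(x, y)"])
    qed
  qed
  then have "card (out E ((A \<union> E `` A) - {t})) \<le> card (\<Union>e\<in>out E A. f e)"
    by (intro card_mono) (use fin finite_out[OF assms(1)] in \<open>auto simp: f_def\<close>)
  also have "\<dots> \<le> (\<Sum>e\<in>out E A. card (f e))"
    by (rule card_UN_le[OF finite_out[OF assms(1)]])
  also have "\<dots> \<le> (\<Sum>e\<in>out E A. 2)"
    by (intro sum_mono) (use deg in \<open>auto simp: f_def card_cartesian_product\<close>)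
  finally show ?thesis by simp
qed

text \<open>
  The stages of the farthest cut construction: \<open>S\<close> becomes \<open>A\<close> together with its out-neighbours, which
  at most doubles the cut, while a path to \<open>t\<close> that survives the faults contributes one more
  reachable source in \<open>S\<close> per stage and thereby raises the cut value by one. The reachable sources
  are reached by paths that do not enter \<open>t\<close>, so they stay reachable when arcs into \<open>t\<close> are dropped.
\<close>

definition escapes ::
  "('a \<times> 'a) set \<Rightarrow> 'a set \<Rightarrow> 'a \<Rightarrow> 'a \<Rightarrow> 'a set \<Rightarrow> 'a set \<Rightarrow> nat \<Rightarrow> ('a \<times> 'a) set \<Rightarrow> bool"
where
  "escapes E V s t S A j F \<longleftrightarrow>
      (\<exists>x\<in>A. (s, x) \<in> (E - into E t - F)\<^sup>* \<and> (x, t) \<in> E - F) \<or>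
      (\<exists>X\<subseteq>S. (\<forall>x\<in>X. (s, x) \<in> (E - into E t - F)\<^sup>*) \<and>
         (\<forall>C. X \<subseteq> C \<and> C \<subseteq> V - {t} \<longrightarrow> j + 1 \<le> card (out E C)))"

lemma escapesE:
  assumes "escapes E V s t S A j F"
    and "\<not> (\<exists>x\<in>A. (s, x) \<in> (E - into E t - F)\<^sup>* \<and> (x, t) \<in> E - F)"
  obtains X where "X \<subseteq> S" "\<And>x. x \<in> X \<Longrightarrow> (s, x) \<in> (E - into E t - F)\<^sup>*"
    "\<And>C. X \<subseteq> C \<Longrightarrow> C \<subseteq> V - {t} \<Longrightarrow> j + 1 \<le> card (out E C)"
proof -
  have "\<exists>X\<subseteq>S. (\<forall>x\<in>X. (s, x) \<in> (E - into E t - F)\<^sup>*) \<and>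
      (\<forall>C. X \<subseteq> C \<and> C \<subseteq> V - {t} \<longrightarrow> j + 1 \<le> card (out E C))"
    using disjE[OF assms(1)[unfolded escapes_def]] assms(2) by argo
  then show thesis by (elim exE conjE) (rule that, auto)
qed

lemma source_chain:
  assumes V: "finite V" "E \<subseteq> V \<times> V" and deg: "\<And>v. card (E `` {v}) \<le> 2"
    and st: "s \<in> V" "s \<noteq> t"
  shows "\<exists>S A. farthest_cut E (V - {t}) S A \<and> s \<in> S \<and> card (out E A) \<le> 2 ^ (j + 1) \<and>
    (\<forall>F. (s, t) \<in> (E - F)\<^sup>* \<longrightarrow> escapes E V s t S A j F)"
proof (induction j)
  case 0
  have fE: "finite E" using V finite_subset by blast
  obtain A where A: "farthest_cut E (V - {t}) {s} A"
    using farthest_cut_exists[of "V - {t}" "{s}" E] V st by auto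
  have "out E {s} \<subseteq> {s} \<times> (E `` {s})" by (auto simp: out_def)
  moreover have fin: "finite ({s} \<times> (E `` {s}))" using fE by auto
  ultimately have "card (out E {s}) \<le> card ({s} \<times> (E `` {s}))" by (rule card_mono[rotated])
  also have "\<dots> \<le> 2" using deg by (simp add: card_cartesian_product)
  finally have "card (out E A) \<le> 2"
    using A st V by (auto simp: farthest_cut_def intro: order_trans)
  moreover have "1 \<le> card (out E C)" if "(s, t) \<in> (E - F)\<^sup>*" "{s} \<subseteq> C" "C \<subseteq> V - {t}" for F C
  proof -
    have "out (E - F) C \<noteq> {}" using rtrancl_leaves[OF that(1), of C] that by blast
    then have "out E C \<noteq> {}" using out_mono[of "E - F" E C] by blast
    then show ?thesis using finite_out[OF fE] by (simp add: Suc_le_eq card_gt_0_iff)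
  qed
  ultimately show ?case using A
    by (intro exI[of _ "{s}"] exI[of _ A]) (auto simp: escapes_def intro!: exI[of _ "{s}"])
next
  case (Suc j)
  have fE: "finite E" using V finite_subset by blast
  from Suc obtain S A where A: "farthest_cut E (V - {t}) S A" "s \<in> S"
    "card (out E A) \<le> 2 ^ (j + 1)" and
    step: "\<And>F. (s, t) \<in> (E - F)\<^sup>* \<Longrightarrow> escapes E V s t S A j F"
    by metis
  have SA: "S \<subseteq> A" "A \<subseteq> V - {t}"
    and Amax: "\<And>C. A \<subset> C \<Longrightarrow> C \<subseteq> V - {t} \<Longrightarrow> card (out E A) < card (out E C)"
    using A(1) by (auto simp: farthest_cut_def)
  define S' where "S' = (A \<union> E `` A) - {t}"
  have AS': "A \<subseteq> S'" and S'V: "S' \<subseteq> V - {t}" using SA V by (auto simp: S'_def)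
  obtain A' where A': "farthest_cut E (V - {t}) S' A'"
    using farthest_cut_exists[OF _ S'V] V by auto
  have S'A': "S' \<subseteq> A'" using A' by (auto simp: farthest_cut_def)
  have "card (out E A') \<le> card (out E S')" using A' S'V by (auto simp: farthest_cut_def)
  also have "\<dots> \<le> 2 * card (out E A)" unfolding S'_def
    by (rule card_out_successors[OF fE deg]) (use SA in auto)
  finally have cA': "card (out E A') \<le> 2 ^ (Suc j + 1)" using A(3) by simp
  have "escapes E V s t S' A' (Suc j) F" if F: "(s, t) \<in> (E - F)\<^sup>*" for F
  proof (cases "\<exists>x\<in>A. (s, x) \<in> (E - into E t - F)\<^sup>* \<and> (x, t) \<in> E - F")
    case True
    then show ?thesis unfolding escapes_def using subsetD[OF S'A', OF subsetD[OF AS']] by metis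
  next
    case False
    obtain X where X: "X \<subseteq> S" "\<And>x. x \<in> X \<Longrightarrow> (s, x) \<in> (E - into E t - F)\<^sup>*"
      "\<And>C. X \<subseteq> C \<Longrightarrow> C \<subseteq> V - {t} \<Longrightarrow> j + 1 \<le> card (out E C)"
      by (rule escapesE[OF step[OF F] False]) blast
    \<comment> \<open>The surviving path leaves the part of \<open>A\<close> that is reachable
      without entering \<open>t\<close>. It does not do so by an arc into \<open>t\<close>, which
      \<open>False\<close> excludes, so the head of the leaving arc is a reachable vertex outside
      \<open>A\<close>: the new source.\<close>
    define Q where "Q = A \<inter> {x. (s, x) \<in> (E - into E t - F)\<^sup>*}"
    have "s \<in> Q" "t \<notin> Q" using A SA by (auto simp: Q_def)
    then have "out (E - F) Q \<noteq> {}" by (rule rtrancl_leaves[OF F])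
    then obtain u v where uv: "(u, v) \<in> E - F" "u \<in> Q" "v \<notin> Q"
      by (auto simp: out_def)
    have vt: "v \<noteq> t" using False uv by (auto simp: Q_def)
    then have "(u, v) \<in> E - into E t - F" using uv by (auto simp: into_def)
    then have v: "(s, v) \<in> (E - into E t - F)\<^sup>*"
      using uv by (auto simp: Q_def intro: rtrancl_into_rtrancl)
    then have vA: "v \<notin> A" using uv by (auto simp: Q_def)
    have vS': "v \<in> S'" using uv vt by (auto simp: S'_def Q_def)
    have "Suc j + 1 \<le> card (out E C)" if C: "insert v X \<subseteq> C" "C \<subseteq> V - {t}" for C
    proof -
      \<comment> \<open>\<open>C \<inter> A\<close> still contains the old sources, while
        \<open>C \<union> A\<close> exceeds \<open>A\<close> by \<open>v\<close> and so has a larger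
        cut than \<open>A\<close>. Submodularity adds the gain to the cut of
        \<open>C\<close>.\<close>
      have "j + 1 \<le> card (out E (C \<inter> A))" using C X(1) SA by (intro X(3)) auto
      moreover have "card (out E A) < card (out E (C \<union> A))"
        using C SA vA by (intro Amax) auto
      ultimately show ?thesis using card_out_submodular[OF fE, of C A] by linarith
    qed
    then show ?thesis
      unfolding escapes_def using X(1,2) vS' v subset_trans[OF SA(1) AS']
      by (intro disjI2 exI[of _ "insert v X"]) auto
  qed
  moreover have "s \<in> S'" using A(2) SA AS' by blast
  ultimately show ?case using A' cA' by metis
qed

text \<open>Suppose the faults cut \<open>t\<close> off in the thinned graph. The arcs leaving the
  reached set are then all faults, at most \<open>k\<close> of them. But this set contains sources
  whose cuts have value at least \<open>k + 1\<close> in \<open>E\<close>, and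
  \<open>few_arcs_into\<close> keeps this value. If instead a reachable vertex of \<open>A\<close>
  has a surviving arc to \<open>t\<close>, that arc is in \<open>D\<close>.\<close>

lemma few_fault_tolerant_arcs_into:
  assumes V: "finite V" "E \<subseteq> V \<times> V" and deg: "\<And>v. card (E `` {v}) \<le> 2" and s: "s \<in> V"
  obtains D where "D \<subseteq> into E t" "card D \<le> 2 ^ (k + 1)"
    "\<And>F. finite F \<Longrightarrow> card F \<le> k \<Longrightarrow> (s, t) \<in> (E - F)\<^sup>* \<Longrightarrow> (s, t) \<in> ((E - into E t) \<union> D - F)\<^sup>*"
proof (cases "s = t")
  case True
  then show thesis using that[of "{}"] by simp
next
  case False
  have fE: "finite E" using V finite_subset by blast
  from source_chain[OF V deg s False, of k] obtain S A where A: "farthest_cut E (V - {t}) S A"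
    "s \<in> S" "card (out E A) \<le> 2 ^ (k + 1)" and
    step: "\<And>F. (s, t) \<in> (E - F)\<^sup>* \<Longrightarrow> escapes E V s t S A k F"
    by metis
  have SA: "S \<subseteq> A" "A \<subseteq> V - {t}" using A(1) by (auto simp: farthest_cut_def)
  obtain D where D: "D \<subseteq> into E t" "card D \<le> card (out E A)"
    "\<And>x. x \<in> A \<Longrightarrow> (x, t) \<in> E \<Longrightarrow> (x, t) \<in> D"
    "\<And>C. C \<subseteq> V - {t} \<Longrightarrow> card (out E (C \<inter> A)) \<le> card (out ((E - into E t) \<union> D) C)"
    by (rule few_arcs_into[OF fE V(1) A(1)]) blast
  define E' where "E' = (E - into E t) \<union> D"
  have E'E: "E' \<subseteq> E" using D(1) by (auto simp: E'_def into_def)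
  have sub: "(E - into E t - F)\<^sup>* \<subseteq> (E' - F)\<^sup>*" for F
    by (rule rtrancl_mono) (auto simp: E'_def)
  have "(s, t) \<in> (E' - F)\<^sup>*" if F: "finite F" "card F \<le> k" "(s, t) \<in> (E - F)\<^sup>*" for F
  proof (cases "\<exists>x\<in>A. (s, x) \<in> (E - into E t - F)\<^sup>* \<and> (x, t) \<in> E - F")
    case True
    then obtain x where x: "x \<in> A" "(s, x) \<in> (E' - F)\<^sup>*" "(x, t) \<in> E - F" using sub by blast
    then have "(x, t) \<in> E' - F" using D(3) by (auto simp: E'_def)
    then show ?thesis using x by (auto intro: rtrancl_into_rtrancl)
  next
    case False
    obtain X where X: "X \<subseteq> S" "\<And>x. x \<in> X \<Longrightarrow> (s, x) \<in> (E - into E t - F)\<^sup>*"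
      "\<And>C. X \<subseteq> C \<Longrightarrow> C \<subseteq> V - {t} \<Longrightarrow> k + 1 \<le> card (out E C)"
      by (rule escapesE[OF step[OF F(3)] False]) blast
    define R where "R = {x. (s, x) \<in> (E' - F)\<^sup>*}"
    have "x \<in> V" if "(s, x) \<in> (E' - F)\<^sup>*" for x
      using that s E'E V(2) by (induction rule: rtrancl_induct) auto
    then have RV: "R \<subseteq> V" by (auto simp: R_def)
    have XR: "X \<subseteq> R" using X(2) sub by (auto simp: R_def)
    have "out E' R \<subseteq> F" by (auto simp: out_def R_def intro: rtrancl_into_rtrancl)
    then have cR: "card (out E' R) \<le> k" using F card_mono order_trans by blast
    show ?thesis
    proof (rule ccontr)
      assume "\<not> ?thesis"
      then have R: "R \<subseteq> V - {t}" using RV by (auto simp: R_def)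
      have "k + 1 \<le> card (out E (R \<inter> A))" using X(1) XR SA R by (intro X(3)) auto
      also have "\<dots> \<le> card (out E' R)" unfolding E'_def by (rule D(4)[OF R])
      finally show False using cR by simp
    qed
  qed
  then show thesis using that[of D] D A(3) unfolding E'_def by auto
qed

section \<open>Single-source preservers\<close>

text \<open>Vertices are thinned one after another, each in the graph already thinned, so in-degrees
  bounded before stay bounded. Thinning at \<open>v\<close> only has to keep \<open>v\<close>
  reachable: on a path to another vertex the arcs ending outside \<open>v\<close> remain, and each
  prefix ending in \<open>v\<close> can be replaced.\<close>

lemma bounded_indegree_preserver:
  assumes V: "finite V" "E \<subseteq> V \<times> V" and deg: "\<And>v. card (E `` {v}) \<le> 2" and s: "s \<in> V"
    and T: "finite T"
  shows "\<exists>H\<subseteq>E. (\<forall>v\<in>T. card (into H v) \<le> 2 ^ (k + 1)) \<and>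
    (\<forall>F x. finite F \<longrightarrow> card F \<le> k \<longrightarrow> (s, x) \<in> (E - F)\<^sup>* \<longrightarrow> (s, x) \<in> (H - F)\<^sup>*)"
  using T
proof (induction T)
  case empty
  show ?case by (intro exI[of _ E]) auto
next
  case (insert v T)
  then obtain H where H: "H \<subseteq> E" "\<And>w. w \<in> T \<Longrightarrow> card (into H w) \<le> 2 ^ (k + 1)"
    and pres: "\<And>F x. finite F \<Longrightarrow> card F \<le> k \<Longrightarrow> (s, x) \<in> (E - F)\<^sup>* \<Longrightarrow> (s, x) \<in> (H - F)\<^sup>*"
    by metis
  have fE: "finite E" using V finite_subset by blast
  then have fH: "finite H" using H finite_subset by blast
  have degH: "card (H `` {v}) \<le> 2" for v
    by (rule order_trans[OF card_mono deg[of v]]) (use H fE in auto)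
  have HV: "H \<subseteq> V \<times> V" using H V by blast
  obtain D where D: "D \<subseteq> into H v" "card D \<le> 2 ^ (k + 1)"
    "\<And>F. finite F \<Longrightarrow> card F \<le> k \<Longrightarrow> (s, v) \<in> (H - F)\<^sup>* \<Longrightarrow> (s, v) \<in> ((H - into H v) \<union> D - F)\<^sup>*"
    using few_fault_tolerant_arcs_into[OF V(1) HV degH s, where t = v and k = k] by blast
  define H' where "H' = (H - into H v) \<union> D"
  have H'H: "H' \<subseteq> H" using D by (auto simp: H'_def into_def)
  have "into H' v = D" using D(1) by (auto simp: H'_def into_def)
  moreover have "card (into H' w) \<le> card (into H w)" for w
    by (rule card_mono) (use H'H fH in \<open>auto simp: into_def\<close>)
  ultimately have "\<forall>w\<in>insert v T. card (into H' w) \<le> 2 ^ (k + 1)"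
    using H(2) D(2) by (auto intro: order_trans)
  moreover have "(s, x) \<in> (H' - F)\<^sup>*" if F: "finite F" "card F \<le> k" "(s, x) \<in> (E - F)\<^sup>*" for F x
    using pres[OF F]
  proof (induction rule: rtrancl_induct)
    case base
    show ?case by simp
  next
    case (step y z)
    show ?case
    proof (cases "z = v")
      case True
      then show ?thesis
        using D(3)[OF F(1,2)] step by (auto simp: H'_def intro: rtrancl_into_rtrancl)
    next
      case False
      then have "(y, z) \<in> H' - F" using step by (auto simp: H'_def into_def)
      then show ?thesis using step by (auto intro: rtrancl_into_rtrancl)
    qed
  qed
  ultimately show ?case using H'H H(1) by (intro exI[of _ H']) blast
qed

text \<open>
  Out-degree two is achieved by replacing every vertex \<open>v\<close> by a path \<open>(v, 0), (v, 1), \<dots>\<close> whose node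
  \<open>(v, c w)\<close> carries the arc to \<open>w\<close>. Only the nodes \<open>(w, 0)\<close> receive arcs of the original graph.
\<close>

theorem single_source_preserver:
  assumes V: "finite V" "E \<subseteq> V \<times> V" and s: "s \<in> V"
  obtains H where "H \<subseteq> E" "card H \<le> 2 ^ (k + 1) * card V"
    "\<And>F x. finite F \<Longrightarrow> card F \<le> k \<Longrightarrow> (s, x) \<in> (E - F)\<^sup>* \<Longrightarrow> (s, x) \<in> (H - F)\<^sup>*"
proof -
  obtain c :: "'a \<Rightarrow> nat" and N where c: "c ` V = {i. i < N}" "inj_on c V"
    using finite_imp_inj_to_nat_seg[OF V(1)] by metis
  define \<phi> where "\<phi> = (\<lambda>(v::'a, w::'a). ((v, c w), (w, 0::nat)))"
  define B where "B = {((v, i), (v, Suc i)) | v i. v \<in> V \<and> i < N} \<union> \<phi> ` E"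
  have inj: "inj \<phi>" by (auto simp: inj_def \<phi>_def)
  have cN: "c w < N" if "w \<in> V" for w using c(1) that by auto
  have BV: "B \<subseteq> (V \<times> {..N}) \<times> (V \<times> {..N})"
    using V(2) cN by (fastforce simp: B_def \<phi>_def)
  have fV: "finite (V \<times> {..N})" using V by simp
  have deg: "card (B `` {p}) \<le> 2" for p
  proof -
    obtain v i where p: "p = (v, i)" by force
    have "\<exists>w0. \<forall>w. (v, w) \<in> E \<and> c w = i \<longrightarrow> w = w0"
      using c(2) V(2) by (metis (no_types, lifting) inj_onD mem_Sigma_iff subsetD)
    then obtain w0 where "\<And>w. (v, w) \<in> E \<Longrightarrow> c w = i \<Longrightarrow> w = w0" by blast
    then have "B `` {p} \<subseteq> {(v, Suc i), (w0, 0)}" by (auto simp: p B_def \<phi>_def)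
    then have "card (B `` {p}) \<le> card {(v, Suc i), (w0, 0)}" by (intro card_mono) auto
    also have "\<dots> \<le> 2" by (simp add: card_insert_if)
    finally show ?thesis .
  qed
  have "(s, 0) \<in> V \<times> {..N}" using s by simp
  from bounded_indegree_preserver[OF fV BV deg this fV]
  obtain K where K: "K \<subseteq> B" "\<And>p. p \<in> V \<times> {..N} \<Longrightarrow> card (into K p) \<le> 2 ^ (k + 1)"
    and pres: "\<And>F x. finite F \<Longrightarrow> card F \<le> k \<Longrightarrow> ((s, 0), x) \<in> (B - F)\<^sup>* \<Longrightarrow> ((s, 0), x) \<in> (K - F)\<^sup>*"
    by metis
  have fK: "finite K" using K(1) BV fV by (meson finite_SigmaI finite_subset)
  define H where "H = {e \<in> E. \<phi> e \<in> K}"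
  have HV: "H \<subseteq> V \<times> V" using V by (auto simp: H_def)
  have "card H = card (\<phi> ` H)" by (rule card_image[symmetric]) (use inj in \<open>auto simp: inj_on_def\<close>)
  also have "\<dots> \<le> card (\<Union>w\<in>V. into K (w, 0))"
  proof (rule card_mono)
    show "finite (\<Union>w\<in>V. into K (w, 0))" using V fK by (auto simp: into_def)
    show "\<phi> ` H \<subseteq> (\<Union>w\<in>V. into K (w, 0))"
      using HV by (fastforce simp: H_def \<phi>_def into_def)
  qed
  also have "\<dots> \<le> (\<Sum>w\<in>V. card (into K (w, 0)))" by (rule card_UN_le[OF V(1)])
  also have "\<dots> \<le> (\<Sum>w\<in>V. 2 ^ (k + 1))" by (intro sum_mono K) auto
  finally have cH: "card H \<le> 2 ^ (k + 1) * card V" by (simp add: mult.commute)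
  have "(s, x) \<in> (H - F)\<^sup>*" if F: "finite F" "card F \<le> k" "(s, x) \<in> (E - F)\<^sup>*" for F x
  proof -
    \<comment> \<open>Chain arcs end at positive indices and images of arcs of \<open>E\<close> at
      index 0, so the images of the faults hit no chain.\<close>
    have chain: "i \<le> N \<Longrightarrow> v \<in> V \<Longrightarrow> ((v, 0), (v, i)) \<in> (B - \<phi> ` F)\<^sup>*" for v i
    proof (induction i)
      case (Suc i)
      have "((v, i), (v, Suc i)) \<in> B - \<phi> ` F" using Suc by (auto simp: B_def \<phi>_def)
      then show ?case using Suc by (auto intro: rtrancl_into_rtrancl)
    qed simp
    have "((s, 0), (x, 0)) \<in> (B - \<phi> ` F)\<^sup>*"
      using F(3)
    proof (induction rule: rtrancl_induct)
      case (step y z)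
      then have yz: "y \<in> V" "z \<in> V" using V by auto
      have "\<phi> (y, z) \<in> B - \<phi> ` F" using step inj by (auto simp: B_def inj_image_mem_iff)
      then have "((y, c z), (z, 0)) \<in> B - \<phi> ` F" by (simp add: \<phi>_def)
      moreover have "((y, 0), (y, c z)) \<in> (B - \<phi> ` F)\<^sup>*" using chain yz cN by (simp add: less_imp_le)
      ultimately show ?case using step.IH by (meson rtrancl_into_rtrancl rtrancl_trans)
    qed simp
    moreover have "card (\<phi> ` F) \<le> k" using F card_image_le order_trans by blast
    ultimately have "((s, 0), (x, 0)) \<in> (K - \<phi> ` F)\<^sup>*" using pres F(1) by blast
    \<comment> \<open>Projection to first components contracts the chains and maps the kept arcs to
      arcs of \<open>H\<close>.\<close>
    then have "(s, fst (x, 0::nat)) \<in> (H - F)\<^sup>*"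
    proof (induction rule: rtrancl_induct)
      case (step p q)
      have "fst q = fst p \<or> (fst p, fst q) \<in> H - F"
        using step(2) K(1) by (fastforce simp: B_def H_def \<phi>_def)
      then show ?case using step.IH by (metis rtrancl_into_rtrancl)
    qed simp
    then show ?thesis by simp
  qed
  then show thesis using that[of H] cH by (auto simp: H_def)
qed

lemma rtrancl_converse_iff: "(x, y) \<in> (E\<inverse>)\<^sup>* \<longleftrightarrow> (y, x) \<in> E\<^sup>*"
  by (simp add: rtrancl_converse)

lemma converse_minus: "(E - F)\<inverse> = E\<inverse> - F\<inverse>"
  by auto

theorem single_target_preserver:
  assumes V: "finite V" "E \<subseteq> V \<times> V" and t: "t \<in> V"
  obtains H where "H \<subseteq> E" "card H \<le> 2 ^ (k + 1) * card V"
    "\<And>F x. finite F \<Longrightarrow> card F \<le> k \<Longrightarrow> (x, t) \<in> (E - F)\<^sup>* \<Longrightarrow> (x, t) \<in> (H - F)\<^sup>*"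
proof -
  have "E\<inverse> \<subseteq> V \<times> V" using V by auto
  then obtain H where H: "H \<subseteq> E\<inverse>" "card H \<le> 2 ^ (k + 1) * card V"
    "\<And>F x. finite F \<Longrightarrow> card F \<le> k \<Longrightarrow> (t, x) \<in> (E\<inverse> - F)\<^sup>* \<Longrightarrow> (t, x) \<in> (H - F)\<^sup>*"
    using single_source_preserver[OF V(1) _ t, of "E\<inverse>" k] by blast
  have "(x, t) \<in> (H\<inverse> - F)\<^sup>*" if F: "finite F" "card F \<le> k" "(x, t) \<in> (E - F)\<^sup>*" for F x
  proof -
    have "(t, x) \<in> ((E - F)\<inverse>)\<^sup>*" using F(3) by (simp add: rtrancl_converse_iff)
    then have "(t, x) \<in> (E\<inverse> - F\<inverse>)\<^sup>*" by (simp add: converse_minus)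
    then have "(t, x) \<in> (H - F\<inverse>)\<^sup>*" using F by (intro H(3)) auto
    then have "(t, x) \<in> ((H\<inverse> - F)\<inverse>)\<^sup>*" by (simp add: converse_minus)
    then show ?thesis by (simp add: rtrancl_converse_iff)
  qed
  moreover have "H\<inverse> \<subseteq> E" using H by auto
  ultimately show thesis using that[of "H\<inverse>"] H by auto
qed

section \<open>Hitting sets\<close>

text \<open>Averaging: summed over all \<open>v\<close>, the number of sets missed by
  \<open>v\<close> equals the sum of \<open>card (U - X)\<close>, which is at most
  \<open>card U - c\<close> per set. Some vertex does no worse than the mean.\<close>

lemma hitting_set_step:
  assumes U: "finite U" "0 < card U" and \<F>: "finite \<F>" "\<And>X. X \<in> \<F> \<Longrightarrow> X \<subseteq> U \<and> c \<le> real (card X)"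
  obtains v where "v \<in> U" "real (card {X \<in> \<F>. v \<notin> X}) \<le> (1 - c / card U) * card \<F>"
proof (rule ccontr)
  assume "\<not> thesis"
  then have less: "\<And>v. v \<in> U \<Longrightarrow> (1 - c / card U) * card \<F> < card {X \<in> \<F>. v \<notin> X}"
    using that by force
  have ne: "U \<noteq> {}" using U by auto
  have "real (card U) * ((1 - c / card U) * card \<F>) = (\<Sum>v\<in>U. (1 - c / card U) * card \<F>)" by simp
  also have "\<dots> < (\<Sum>v\<in>U. real (card {X \<in> \<F>. v \<notin> X}))"
    by (rule sum_strict_mono[OF U(1) ne less])
  also have "\<dots> = (\<Sum>v\<in>U. \<Sum>X\<in>\<F>. of_bool (v \<notin> X))"
    by (intro sum.cong refl) (use \<F>(1) in \<open>simp add: of_bool_def sum.If_cases Int_def conj_commute\<close>)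
  also have "\<dots> = (\<Sum>X\<in>\<F>. \<Sum>v\<in>U. of_bool (v \<notin> X))" by (rule sum.swap)
  also have "\<dots> = (\<Sum>X\<in>\<F>. real (card (U - X)))"
    by (intro sum.cong refl) (use U(1) in \<open>simp add: of_bool_def sum.If_cases Diff_eq Compl_eq\<close>)
  also have "\<dots> \<le> (\<Sum>X\<in>\<F>. card U - c)"
  proof (rule sum_mono)
    fix X assume "X \<in> \<F>"
    then have X: "X \<subseteq> U" "c \<le> card X" using \<F>(2) by auto
    then have "card (U - X) = card U - card X" "card X \<le> card U"
      using U(1) by (auto simp: card_Diff_subset finite_subset intro: card_mono)
    then show "real (card (U - X)) \<le> card U - c" using X by (simp add: of_nat_diff)
  qed
  also have "\<dots> = real (card U) * ((1 - c / card U) * card \<F>)"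
    using U(2) ne by (simp add: field_simps)
  finally show False by simp
qed

lemma hitting_set_iterated:
  fixes c :: real
  assumes U: "finite U" "0 < card U" and c: "c \<le> card U"
    and \<F>: "finite \<F>" "\<And>X. X \<in> \<F> \<Longrightarrow> X \<subseteq> U \<and> c \<le> real (card X)"
  shows "\<exists>R\<subseteq>U. card R \<le> m \<and> real (card {X \<in> \<F>. R \<inter> X = {}}) \<le> (1 - c / card U) ^ m * card \<F>"
proof (induction m)
  case 0
  show ?case by (intro exI[of _ "{}"]) simp
next
  case (Suc m)
  then obtain R where R: "R \<subseteq> U" "card R \<le> m"
    "real (card {X \<in> \<F>. R \<inter> X = {}}) \<le> (1 - c / card U) ^ m * card \<F>" by blast
  define \<F>' where "\<F>' = {X \<in> \<F>. R \<inter> X = {}}"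
  have "finite \<F>'" using \<F> by (simp add: \<F>'_def)
  then obtain v where v: "v \<in> U" "real (card {X \<in> \<F>'. v \<notin> X}) \<le> (1 - c / card U) * card \<F>'"
    by (rule hitting_set_step[OF U, of \<F>' c]) (use \<F>(2) in \<open>auto simp: \<F>'_def\<close>)
  have "{X \<in> \<F>'. v \<notin> X} = {X \<in> \<F>. insert v R \<inter> X = {}}" by (auto simp: \<F>'_def)
  then have "real (card {X \<in> \<F>. insert v R \<inter> X = {}}) \<le> (1 - c / card U) * card \<F>'"
    using v by simp
  also have "\<dots> \<le> (1 - c / card U) * ((1 - c / card U) ^ m * card \<F>)"
    using R(3) c U by (intro mult_left_mono) (auto simp: \<F>'_def field_simps)
  finally have "real (card {X \<in> \<F>. insert v R \<inter> X = {}}) \<le> (1 - c / card U) ^ Suc m * card \<F>"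
    by simp
  moreover have "card (insert v R) \<le> Suc m"
    using R finite_subset[OF R(1) U(1)] by (simp add: card_insert_if)
  ultimately show ?case using R v by (intro exI[of _ "insert v R"]) auto
qed

lemma hitting_set:
  assumes U: "finite U" "0 < card U" and c: "0 < c" and N: "real (card \<F>) \<le> N" "1 \<le> N"
    and \<F>: "finite \<F>" "\<And>X. X \<in> \<F> \<Longrightarrow> X \<subseteq> U \<and> c \<le> real (card X)"
  obtains R where "R \<subseteq> U" "real (card R) \<le> card U / c * ln N + 1" "\<And>X. X \<in> \<F> \<Longrightarrow> R \<inter> X \<noteq> {}"
proof (cases "c \<le> card U")
  case False
  have "X \<notin> \<F>" for X
  proof
    assume "X \<in> \<F>"
    then have "X \<subseteq> U" "c \<le> card X" using \<F>(2) by auto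
    then show False using card_mono[OF U(1), of X] False by linarith
  qed
  moreover have "0 \<le> card U / c * ln N" using N c by simp
  ultimately show thesis by (intro that[of "{}"]) auto
next
  case True
  define q where "q = card U / c * ln N"
  \<comment> \<open>The added 1 makes \<open>m\<close> strictly larger than \<open>q\<close>. Then
    (1 - c / card U)^m \<le> exp (- c m / card U) < 1 / N, and fewer than one set, hence none,
    remains unhit.\<close>
  define m where "m = nat \<lfloor>q\<rfloor> + 1"
  have q: "0 \<le> q" using N c by (simp add: q_def)
  have m: "q < m" "real m \<le> q + 1" using q by (auto simp: m_def) linarith+
  obtain R where R: "R \<subseteq> U" "card R \<le> m"
    "real (card {X \<in> \<F>. R \<inter> X = {}}) \<le> (1 - c / card U) ^ m * card \<F>"
    using hitting_set_iterated[OF U True \<F>] by blast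
  have "(1 - c / card U) ^ m \<le> exp (- (c / card U)) ^ m"
    using True U exp_ge_add_one_self[of "- (c / card U)"] by (intro power_mono) (auto simp: field_simps)
  also have "\<dots> = exp (- (c / card U * m))" by (simp add: exp_of_nat_mult[symmetric] mult.commute)
  also have "\<dots> < exp (- (c / card U * q))"
    using m(1) c U by (simp add: divide_strict_right_mono)
  also have "\<dots> = 1 / N" using c U(2) N card_gt_0_iff[of U] by (simp add: q_def exp_minus field_simps)
  finally have less: "(1 - c / card U) ^ m < 1 / N" .
  have "(1 - c / card U) ^ m * card \<F> < 1"
  proof (cases "card \<F> = 0")
    case False
    then have "(1 - c / card U) ^ m * card \<F> < 1 / N * card \<F>"
      using less by (intro mult_strict_right_mono) auto
    also have "\<dots> \<le> 1" using N by (simp add: field_simps)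
    finally show ?thesis .
  qed simp
  then have "card {X \<in> \<F>. R \<inter> X = {}} = 0" using R(3) by linarith
  then have "{X \<in> \<F>. R \<inter> X = {}} = {}" using \<F>(1) by simp
  then show thesis using R m by (intro that[of R]) (auto simp: q_def)
qed

section \<open>Preservers for one pair\<close>

text \<open>Applied to \<open>E - F\<close>, this is the set of good vertices for the pair and the
  fault set \<open>F\<close>.\<close>

definition through :: "('a \<times> 'a) set \<Rightarrow> 'a \<Rightarrow> 'a \<Rightarrow> 'a set" where
  "through E s t = {x. (s, x) \<in> E\<^sup>* \<and> (x, t) \<in> E\<^sup>*}"

lemma through_mono: "E \<subseteq> E' \<Longrightarrow> through E s t \<subseteq> through E' s t"
  using rtrancl_mono[of E E'] by (auto simp: through_def)

lemma finite_through:
  assumes "finite V" "E \<subseteq> V \<times> V" "s \<in> V"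
  shows "finite (through E s t)"
proof (rule finite_subset)
  have "x \<in> V" if "(s, x) \<in> E\<^sup>*" for x
    using that assms by (induction rule: rtrancl_induct) auto
  then show "through E s t \<subseteq> V" by (auto simp: through_def)
qed (rule assms)

lemma rtrancl_within_through:
  assumes "E' \<subseteq> E" "(s, x) \<in> E'\<^sup>*" "(x, t) \<in> E'\<^sup>*"
  shows "(s, x) \<in> (E' \<inter> through E s t \<times> through E s t)\<^sup>*"
  using assms(2,3)
proof (induction rule: rtrancl_induct)
  case (step y z)
  have yt: "(y, t) \<in> E'\<^sup>*" using step by (meson converse_rtrancl_into_rtrancl)
  have "(s, z) \<in> E'\<^sup>*" using step by (meson rtrancl_into_rtrancl)
  then have "y \<in> through E' s t" "z \<in> through E' s t" using step yt by (auto simp: through_def)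
  then have "(y, z) \<in> E' \<inter> through E s t \<times> through E s t"
    using through_mono[OF assms(1)] step by blast
  then show ?case using step.IH[OF yt] by (rule rtrancl_into_rtrancl[rotated])
qed simp

text \<open>Faults only shrink the set of vertices on walks from \<open>s\<close> to
  \<open>t\<close>, so all surviving walks stay in the subgraph induced by
  \<open>through E s t\<close>, and a single-source preserver of this subgraph is enough. With
  \<open>k = 0\<close> the result serves as a short path.\<close>

lemma narrow_pair_preserver:
  assumes V: "finite V" "E \<subseteq> V \<times> V" "s \<in> V"
  obtains W where "W \<subseteq> E" "card W \<le> 2 ^ (k + 1) * card (through E s t)"
    "\<And>F. finite F \<Longrightarrow> card F \<le> k \<Longrightarrow> (s, t) \<in> (E - F)\<^sup>* \<Longrightarrow> (s, t) \<in> (W - F)\<^sup>*"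
proof (cases "(s, t) \<in> E\<^sup>*")
  case False
  then have "(s, t) \<notin> (E - F)\<^sup>*" for F using rtrancl_mono[of "E - F" E] by blast
  then show thesis using that[of "{}"] by auto
next
  case True
  define U where "U = through E s t"
  have sU: "s \<in> U" using True by (simp add: U_def through_def)
  have fU: "finite U" unfolding U_def by (rule finite_through[OF V])
  obtain W where W: "W \<subseteq> E \<inter> U \<times> U" "card W \<le> 2 ^ (k + 1) * card U"
    "\<And>F x. finite F \<Longrightarrow> card F \<le> k \<Longrightarrow> (s, x) \<in> (E \<inter> U \<times> U - F)\<^sup>* \<Longrightarrow> (s, x) \<in> (W - F)\<^sup>*"
    by (rule single_source_preserver[OF fU _ sU, of "E \<inter> U \<times> U" k]) blast+
  have "(s, t) \<in> (W - F)\<^sup>*" if F: "finite F" "card F \<le> k" "(s, t) \<in> (E - F)\<^sup>*" for F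
  proof -
    have "(s, t) \<in> ((E - F) \<inter> U \<times> U)\<^sup>*"
      unfolding U_def by (rule rtrancl_within_through) (use F in auto)
    moreover have "(E - F) \<inter> U \<times> U = E \<inter> U \<times> U - F" by blast
    ultimately show ?thesis using W(3) F by simp
  qed
  then show thesis using that[of W] W U_def by auto
qed


section \<open>Separating arcs and a single fault\<close>

text \<open>
  The arcs separating \<open>s\<close> from \<open>r\<close> are linearly ordered; \<open>d\<close> is the first of them in \<open>Z\<close>, and a path
  that avoids \<open>d\<close> never gets to the others.
\<close>

lemma first_separator:
  assumes V: "finite V" "E \<subseteq> V \<times> V" and s: "s \<in> V" and sr: "(s, r) \<in> E\<^sup>*"
    and Z: "Z \<noteq> {}" "\<And>e. e \<in> Z \<Longrightarrow> (s, r) \<notin> (E - {e})\<^sup>*"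
  shows "\<exists>d\<in>Z. \<forall>e\<in>Z. \<forall>T x y. (s, x) \<in> (E - {d})\<^sup>* \<longrightarrow> T \<subseteq> E - {d} \<longrightarrow> (x, y) \<in> T\<^sup>* \<longrightarrow>
    (x, y) \<in> (T - {e})\<^sup>*"
proof -
  define A where "A e = {x. (s, x) \<in> (E - {e})\<^sup>*}" for e
  \<comment> \<open>The first separator is found by cardinality of the source side; uncrossing turns
    the comparison of sizes into inclusion \<open>A d \<subseteq> A e\<close>.\<close>
  obtain d where d: "d \<in> Z" and dmin: "\<And>e. e \<in> Z \<Longrightarrow> card (A d) \<le> card (A e)"
    using Z(1) ex_has_least_nat[of "\<lambda>e. e \<in> Z" _ "\<lambda>e. card (A e)"] by blast
  have sA: "s \<in> A e" for e by (simp add: A_def)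
  have rA: "r \<notin> A e" if "e \<in> Z" for e using Z(2)[OF that] by (simp add: A_def)
  have AV: "A e \<subseteq> V" for e
  proof
    fix x assume "x \<in> A e"
    then have "(s, x) \<in> (E - {e})\<^sup>*" by (simp add: A_def)
    then show "x \<in> V" using s V(2) by (induction rule: rtrancl_induct) auto
  qed
  have fA: "finite (A e)" for e using AV V(1) finite_subset by blast
  have outA: "out E (A e) = {e}" if "e \<in> Z" for e
  proof -
    have "out E (A e) \<subseteq> {e}" by (auto simp: out_def A_def intro: rtrancl_into_rtrancl)
    moreover have "out E (A e) \<noteq> {}" by (rule rtrancl_leaves[OF sr sA rA[OF that]])
    ultimately show ?thesis by blast
  qed
  have A_least: "A e \<subseteq> D" if "s \<in> D" "out E D \<subseteq> {e}" for e D
  proof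
    fix x assume "x \<in> A e"
    then have "(s, x) \<in> (E - {e})\<^sup>*" by (simp add: A_def)
    moreover have "out (E - {e}) D = {}" using that(2) by (auto simp: out_def)
    ultimately show "x \<in> D" using rtrancl_closed that(1) by metis
  qed
  have AA: "A d \<subseteq> A e" if e: "e \<in> Z" for e
  proof -
    define D where "D = A e \<inter> A d"
    have sD: "s \<in> D" using sA by (simp add: D_def)
    have "out E D \<subseteq> out E (A e) \<union> out E (A d)" by (auto simp: out_def D_def)
    then have outD: "out E D \<subseteq> {e, d}" using outA[OF e] outA[OF d] by auto
    consider "out E D \<subseteq> {d}" | "out E D \<subseteq> {e}" | "e \<noteq> d" "e \<in> out E D" "d \<in> out E D"
      using outD by blast
    then show ?thesis
    proof cases
      case 1
      then show ?thesis using A_least[OF sD] by (auto simp: D_def)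
    next
      case 2
      then have "A e \<subseteq> A d" using A_least[OF sD] by (auto simp: D_def)
      then show ?thesis using card_seteq[OF fA] dmin[OF e] by blast
    next
      case 3
      \<comment> \<open>If \<open>e\<close> and \<open>d\<close> both leave the intersection, each
        of them ends inside the other set. Then no arc leaves the union, although \<open>r\<close>
        lies outside it.\<close>
      have sub: "out E (A e \<union> A d) \<subseteq> out E (A e) \<union> out E (A d)" by (auto simp: out_def)
      have "e \<in> out E (A d) \<or> snd e \<in> A d" "d \<in> out E (A e) \<or> snd d \<in> A e"
        using 3 by (auto simp: out_def D_def)
      then have "snd e \<in> A d" "snd d \<in> A e" using outA[OF e] outA[OF d] 3(1) by auto
      then have "e \<notin> out E (A e \<union> A d)" "d \<notin> out E (A e \<union> A d)" by (auto simp: out_def)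
      then have "out E (A e \<union> A d) = {}" using sub outA[OF e] outA[OF d] by auto
      then have "r \<in> A e \<union> A d" using rtrancl_closed[OF sr] sA by blast
      then show ?thesis using rA e d by blast
    qed
  qed
  \<comment> \<open>A walk that avoids \<open>d\<close> stays in \<open>A d\<close>, hence in
    \<open>A e\<close>, while \<open>e\<close> ends outside \<open>A e\<close>. The arc set
    \<open>T\<close> is arbitrary because both \<open>E - {d}\<close> and a sparse preserver are put
    in its place later.\<close>
  have "(x, y) \<in> (T - {e})\<^sup>*"
    if e: "e \<in> Z" and x: "(s, x) \<in> (E - {d})\<^sup>*" and T: "T \<subseteq> E - {d}" and xy: "(x, y) \<in> T\<^sup>*" for e T x y
  proof -
    have "(x, y) \<in> (T - {e})\<^sup>* \<and> y \<in> A d"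
      using xy
    proof (induction rule: rtrancl_induct)
      case base
      show ?case using x by (simp add: A_def)
    next
      case (step y z)
      then have "(y, z) \<in> E - {d}" using T by blast
      then have z: "z \<in> A d" using step.IH by (auto simp: A_def intro: rtrancl_into_rtrancl)
      have "e \<in> out E (A e)" using outA[OF e] by blast
      then have "snd e \<notin> A e" by (auto simp: out_def)
      then have "(y, z) \<noteq> e" using z AA[OF e] by auto
      then have "(y, z) \<in> T - {e}" using step by blast
      then show ?case using step.IH z by (meson rtrancl_into_rtrancl)
    qed
    then show ?thesis ..
  qed
  then show ?thesis using d by (intro bexI[of _ d] ballI allI impI)
qed

text \<open>Everything is decided at the first separator \<open>d\<close>. If some vertex of
  \<open>R\<close> is good after removing \<open>d\<close>, its walks avoid all other separators in
  \<open>Z\<close> as well, so no fault in \<open>Z\<close> has to be served. Otherwise a preserver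
  for no faults in \<open>E - {d}\<close>, with two arcs for each of at most \<open>L\<close>
  vertices, serves all of \<open>Z\<close>.\<close>

lemma separator_preserver:
  assumes V: "finite V" "E \<subseteq> V \<times> V" "s \<in> V" and sr: "(s, r) \<in> E\<^sup>*"
    and narrow: "\<And>e. e \<in> E \<Longrightarrow> R \<inter> through (E - {e}) s t = {} \<Longrightarrow> card (through (E - {e}) s t) \<le> L"
  shows "\<exists>W\<subseteq>E. card W \<le> 2 * L \<and> (\<forall>e\<in>E. (s, t) \<in> (E - {e})\<^sup>* \<longrightarrow> (s, r) \<notin> (E - {e})\<^sup>* \<longrightarrow>
    R \<inter> through (E - {e}) s t = {} \<longrightarrow> (s, t) \<in> (W - {e})\<^sup>*)"
proof -
  define Z where "Z = {e \<in> E. (s, t) \<in> (E - {e})\<^sup>* \<and> (s, r) \<notin> (E - {e})\<^sup>*}"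
  show ?thesis
  proof (cases "Z = {}")
    case True
    then show ?thesis by (intro exI[of _ "{}"]) (auto simp: Z_def)
  next
    case False
    have "\<And>e. e \<in> Z \<Longrightarrow> (s, r) \<notin> (E - {e})\<^sup>*" by (simp add: Z_def)
    from first_separator[OF V sr False this] obtain d where d: "d \<in> Z" and
      avoid: "\<forall>e\<in>Z. \<forall>T x y. (s, x) \<in> (E - {d})\<^sup>* \<longrightarrow> T \<subseteq> E - {d} \<longrightarrow> (x, y) \<in> T\<^sup>* \<longrightarrow>
        (x, y) \<in> (T - {e})\<^sup>*" ..
    show ?thesis
    proof (cases "R \<inter> through (E - {d}) s t = {}")
      case False
      then obtain q where q: "q \<in> R" "(s, q) \<in> (E - {d})\<^sup>*" "(q, t) \<in> (E - {d})\<^sup>*"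
        by (auto simp: through_def)
      have "R \<inter> through (E - {e}) s t \<noteq> {}" if e: "e \<in> Z" for e
      proof -
        have "(s, q) \<in> (E - {d} - {e})\<^sup>*" "(q, t) \<in> (E - {d} - {e})\<^sup>*"
          using bspec[OF avoid e] q by blast+
        moreover have "(E - {d} - {e})\<^sup>* \<subseteq> (E - {e})\<^sup>*" by (rule rtrancl_mono) auto
        ultimately show ?thesis using q(1) by (auto simp: through_def)
      qed
      then show ?thesis by (intro exI[of _ "{}"]) (auto simp: Z_def)
    next
      case True
      have "E - {d} \<subseteq> V \<times> V" using V by auto
      then obtain W where W: "W \<subseteq> E - {d}" "card W \<le> 2 ^ (0 + 1) * card (through (E - {d}) s t)"
        "\<And>F. finite F \<Longrightarrow> card F \<le> 0 \<Longrightarrow> (s, t) \<in> (E - {d} - F)\<^sup>* \<Longrightarrow> (s, t) \<in> (W - F)\<^sup>*"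
        using narrow_pair_preserver[OF V(1) _ V(3)] by metis
      have "(s, t) \<in> W\<^sup>*" using W(3)[of "{}"] d by (auto simp: Z_def)
      then have "(s, t) \<in> (W - {e})\<^sup>*" if "e \<in> Z" for e
        using bspec[OF avoid that] W(1) by blast
      moreover have "card (through (E - {d}) s t) \<le> L" using narrow[of d] d True by (auto simp: Z_def)
      ultimately show ?thesis using W by (intro exI[of _ W]) (auto simp: Z_def)
    qed
  qed
qed

lemma through_converse: "through (E\<inverse>) t s = through E s t"
  by (auto simp: through_def rtrancl_converse_iff)

text \<open>If no vertex of \<open>R\<close> is good without faults, the pair is narrow from the
  start and a one-fault preserver has four arcs per vertex. Otherwise fix a good \<open>r\<close> in
  \<open>R\<close>: a fault that leaves no good vertex in \<open>R\<close> separates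
  \<open>s\<close> from \<open>r\<close> or \<open>r\<close> from \<open>t\<close>. The two kinds
  cost \<open>2 * L\<close> arcs each, the second by reversing all arcs.\<close>

lemma one_fault_pair_preserver:
  assumes V: "finite V" "E \<subseteq> V \<times> V" "s \<in> V" "t \<in> V"
    and narrow: "\<And>F. F \<subseteq> E \<Longrightarrow> card F \<le> 1 \<Longrightarrow> R \<inter> through (E - F) s t = {} \<Longrightarrow>
      card (through (E - F) s t) \<le> L"
  shows "\<exists>W\<subseteq>E. card W \<le> 4 * L \<and> (\<forall>F\<subseteq>E. card F \<le> 1 \<longrightarrow> (s, t) \<in> (E - F)\<^sup>* \<longrightarrow>
    R \<inter> through (E - F) s t = {} \<longrightarrow> (s, t) \<in> (W - F)\<^sup>*)"
proof (cases "R \<inter> through E s t = {}")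
  case True
  have fE: "finite E" using V finite_subset by blast
  have "card (through E s t) \<le> L" using narrow[of "{}"] True by simp
  moreover obtain W where W: "W \<subseteq> E" "card W \<le> 2 ^ (1 + 1) * card (through E s t)"
    "\<And>F. finite F \<Longrightarrow> card F \<le> 1 \<Longrightarrow> (s, t) \<in> (E - F)\<^sup>* \<Longrightarrow> (s, t) \<in> (W - F)\<^sup>*"
    by (rule narrow_pair_preserver[OF V(1-3), where k = 1 and t = t]) blast
  ultimately show ?thesis using finite_subset[OF _ fE] by (intro exI[of _ W]) auto
next
  case False
  then obtain r where r: "r \<in> R" "(s, r) \<in> E\<^sup>*" "(r, t) \<in> E\<^sup>*" by (auto simp: through_def)
  have fE: "finite E" using V finite_subset by blast
  have narrow1: "card (through (E - {e}) s t) \<le> L"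
    if "e \<in> E" "R \<inter> through (E - {e}) s t = {}" for e
    using narrow[of "{e}"] that by simp
  from separator_preserver[where R = R, OF V(1-3) r(2) narrow1]
  obtain W1 where W1: "W1 \<subseteq> E" "card W1 \<le> 2 * L"
    "\<forall>e\<in>E. (s, t) \<in> (E - {e})\<^sup>* \<longrightarrow> (s, r) \<notin> (E - {e})\<^sup>* \<longrightarrow>
      R \<inter> through (E - {e}) s t = {} \<longrightarrow> (s, t) \<in> (W1 - {e})\<^sup>*" by auto
  have swap: "E\<inverse> - {e} = (E - {prod.swap e})\<inverse>" for e by (cases e) auto
  have V': "E\<inverse> \<subseteq> V \<times> V" using V(2) by auto
  have rt: "(t, r) \<in> (E\<inverse>)\<^sup>*" using r(3) by (simp add: rtrancl_converse_iff)
  have narrow2: "card (through (E\<inverse> - {e}) t s) \<le> L"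
    if "e \<in> E\<inverse>" "R \<inter> through (E\<inverse> - {e}) t s = {}" for e
    using narrow1[of "prod.swap e"] that unfolding swap through_converse by (cases e) simp
  from separator_preserver[where R = R, OF V(1) V' V(4) rt narrow2]
  obtain W2 where W2: "W2 \<subseteq> E\<inverse>" "card W2 \<le> 2 * L"
    "\<forall>e\<in>E\<inverse>. (t, s) \<in> (E\<inverse> - {e})\<^sup>* \<longrightarrow> (t, r) \<notin> (E\<inverse> - {e})\<^sup>* \<longrightarrow>
      R \<inter> through (E\<inverse> - {e}) t s = {} \<longrightarrow> (t, s) \<in> (W2 - {e})\<^sup>*" by auto
  define W where "W = W1 \<union> W2\<inverse>"
  have "card W \<le> card W1 + card (W2\<inverse>)" unfolding W_def by (rule card_Un_le)
  then have "card W \<le> 4 * L" using W1(2) W2(2) by simp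
  moreover have "W \<subseteq> E" using W1(1) W2(1) by (auto simp: W_def)
  moreover have "(s, t) \<in> (W - F)\<^sup>*"
    if F: "F \<subseteq> E" "card F \<le> 1" "(s, t) \<in> (E - F)\<^sup>*" "R \<inter> through (E - F) s t = {}" for F
  proof -
    have "F \<noteq> {}" using F(4) r by (auto simp: through_def)
    then have "card F = 1" using F(1,2) fE finite_subset[of F E] by (simp add: le_Suc_eq)
    then obtain e where e: "F = {e}" using card_1_singletonE by blast
    have "r \<notin> through (E - {e}) s t" using F(4) r(1) e by blast
    then consider "(s, r) \<notin> (E - {e})\<^sup>*" | "(r, t) \<notin> (E - {e})\<^sup>*" by (auto simp: through_def)
    then show ?thesis
    proof cases
      case 1
      then have "(s, t) \<in> (W1 - {e})\<^sup>*" using W1(3) F e by simp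
      moreover have "(W1 - {e})\<^sup>* \<subseteq> (W - F)\<^sup>*" unfolding W_def e by (rule rtrancl_mono) blast
      ultimately show ?thesis by blast
    next
      case 2
      have sw: "E\<inverse> - {prod.swap e} = (E - {e})\<inverse>" unfolding swap by simp
      have "(t, s) \<in> (W2 - {prod.swap e})\<^sup>*"
        using bspec[OF W2(3), of "prod.swap e"] 2 F unfolding sw through_converse e
        by (cases e) (simp add: rtrancl_converse_iff)
      moreover have "W2 - {prod.swap e} = (W2\<inverse> - {e})\<inverse>" by (cases e) auto
      ultimately have "(s, t) \<in> (W2\<inverse> - {e})\<^sup>*" by (simp add: rtrancl_converse_iff)
      moreover have "(W2\<inverse> - {e})\<^sup>* \<subseteq> (W - F)\<^sup>*" unfolding W_def e by (rule rtrancl_mono) blast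
      ultimately show ?thesis by blast
    qed
  qed
  ultimately show ?thesis by (intro exI[of _ W]) blast
qed


section \<open>Branching over several faults\<close>

text \<open>
  If \<open>E - F'\<close> has no short path from \<open>s\<close> to \<open>t\<close>, then neither has \<open>E - F\<close> for any \<open>F \<supseteq> F'\<close>, so all
  these \<open>F\<close> are served by \<open>R\<close>. Otherwise branch over the arcs of a short path.
\<close>

lemma pair_preserver:
  assumes V: "finite V" "E \<subseteq> V \<times> V" "s \<in> V" "t \<in> V" and L: "1 \<le> L"
    and narrow: "\<And>F. F \<subseteq> E \<Longrightarrow> card F \<le> k \<Longrightarrow> R \<inter> through (E - F) s t = {} \<Longrightarrow>
      card (through (E - F) s t) \<le> L"
    and F': "F' \<subseteq> E" "card F' + j + 1 \<le> k"
  shows "\<exists>W\<subseteq>E. card W \<le> (4 * L) ^ (j + 1) \<and>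
    (\<forall>F\<subseteq>E. F' \<subseteq> F \<longrightarrow> card (F - F') \<le> j + 1 \<longrightarrow> (s, t) \<in> (E - F)\<^sup>* \<longrightarrow>
      R \<inter> through (E - F) s t = {} \<longrightarrow> (s, t) \<in> (W - F)\<^sup>*)"
  using F'
proof (induction j arbitrary: F')
  case 0
  \<comment> \<open>With one fault left the branching stops; the arcs in \<open>F'\<close> are
    removed for good and the one-fault preserver is applied to the rest.\<close>
  have V': "E - F' \<subseteq> V \<times> V" using V by auto
  have narrow': "card (through (E - F' - F) s t) \<le> L"
    if F: "F \<subseteq> E - F'" "card F \<le> 1" "R \<inter> through (E - F' - F) s t = {}" for F
  proof -
    have "card (F' \<union> F) \<le> k" using card_Un_le[of F' F] F(2) 0 by simp
    moreover have "E - F' - F = E - (F' \<union> F)" by blast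
    ultimately show ?thesis using narrow[of "F' \<union> F"] F 0 by auto
  qed
  have "\<exists>W\<subseteq>E - F'. card W \<le> 4 * L \<and>
    (\<forall>F\<subseteq>E - F'. card F \<le> 1 \<longrightarrow> (s, t) \<in> (E - F' - F)\<^sup>* \<longrightarrow>
      R \<inter> through (E - F' - F) s t = {} \<longrightarrow> (s, t) \<in> (W - F)\<^sup>*)"
    by (rule one_fault_pair_preserver[where R = R, OF V(1) V' V(3,4) narrow'])
  then obtain W where W: "W \<subseteq> E - F'" "card W \<le> 4 * L"
    "\<forall>F\<subseteq>E - F'. card F \<le> 1 \<longrightarrow> (s, t) \<in> (E - F' - F)\<^sup>* \<longrightarrow>
      R \<inter> through (E - F' - F) s t = {} \<longrightarrow> (s, t) \<in> (W - F)\<^sup>*"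
    by (elim exE conjE) (rule that)
  have "(s, t) \<in> (W - F)\<^sup>*"
    if F: "F \<subseteq> E" "F' \<subseteq> F" "card (F - F') \<le> 0 + 1" "(s, t) \<in> (E - F)\<^sup>*" "R \<inter> through (E - F) s t = {}" for F
  proof -
    have "E - F' - (F - F') = E - F" "W - (F - F') = W - F" using F(2) W(1) by auto
    then show ?thesis using W(3)[rule_format, of "F - F'"] F by auto
  qed
  then show ?case using W(1,2) by (intro exI[of _ W]) auto
next
  case (Suc j)
  have fE: "finite E" using V finite_subset by blast
  show ?case
  \<comment> \<open>The bound \<open>2 * L\<close> is the size of a preserver for no faults of a
    pair with at most \<open>L\<close> good vertices; it plays the role of the path length.\<close>
  proof (cases "\<exists>T\<subseteq>E - F'. card T \<le> 2 * L \<and> (s, t) \<in> T\<^sup>*")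
    case True
    then obtain T where T: "T \<subseteq> E - F'" "card T \<le> 2 * L" "(s, t) \<in> T\<^sup>*" by blast
    have fT: "finite T" using T(1) fE finite_subset by blast
    have "\<exists>W\<subseteq>E. card W \<le> (4 * L) ^ (j + 1) \<and>
      (\<forall>F\<subseteq>E. insert e F' \<subseteq> F \<longrightarrow> card (F - insert e F') \<le> j + 1 \<longrightarrow> (s, t) \<in> (E - F)\<^sup>* \<longrightarrow>
        R \<inter> through (E - F) s t = {} \<longrightarrow> (s, t) \<in> (W - F)\<^sup>*)" if "e \<in> T" for e
    proof (rule Suc.IH)
      show "insert e F' \<subseteq> E" using that T(1) Suc.prems by blast
      show "card (insert e F') + j + 1 \<le> k"
        using Suc.prems finite_subset[OF Suc.prems(1) fE] by (simp add: card_insert_if)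
    qed
    then obtain W where W: "\<And>e. e \<in> T \<Longrightarrow> W e \<subseteq> E" "\<And>e. e \<in> T \<Longrightarrow> card (W e) \<le> (4 * L) ^ (j + 1)"
      and WF: "\<And>e. e \<in> T \<Longrightarrow> \<forall>F\<subseteq>E. insert e F' \<subseteq> F \<longrightarrow> card (F - insert e F') \<le> j + 1 \<longrightarrow>
        (s, t) \<in> (E - F)\<^sup>* \<longrightarrow> R \<inter> through (E - F) s t = {} \<longrightarrow> (s, t) \<in> (W e - F)\<^sup>*"
      by metis
    define X where "X = T \<union> (\<Union>e\<in>T. W e)"
    have "card X \<le> card T + card (\<Union>e\<in>T. W e)" unfolding X_def by (rule card_Un_le)
    also have "card (\<Union>e\<in>T. W e) \<le> (\<Sum>e\<in>T. card (W e))" by (rule card_UN_le[OF fT])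
    also have "\<dots> \<le> (\<Sum>e\<in>T. (4 * L) ^ (j + 1))" by (rule sum_mono) (rule W(2))
    finally have "card X \<le> card T * (1 + (4 * L) ^ (j + 1))" by simp
    \<comment> \<open>The arcs of \<open>T\<close> themselves are absorbed by doubling the cost of
      each branch, which explains the factor \<open>4 * L\<close> per fault.\<close>
    also have "\<dots> \<le> (2 * L) * ((4 * L) ^ (j + 1) + (4 * L) ^ (j + 1))"
      using L one_le_power[of "4 * L" "j + 1"] by (intro mult_mono T add_mono) auto
    also have "\<dots> = (4 * L) ^ (Suc j + 1)" by simp
    finally have cX: "card X \<le> (4 * L) ^ (Suc j + 1)" .
    have "(s, t) \<in> (X - F)\<^sup>*" if F: "F \<subseteq> E" "F' \<subseteq> F" "card (F - F') \<le> Suc j + 1" "(s, t) \<in> (E - F)\<^sup>*"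
      "R \<inter> through (E - F) s t = {}" for F
    proof (cases "T \<inter> F = {}")
      case True
      then have "T \<subseteq> X - F" by (auto simp: X_def)
      then show ?thesis using T(3) rtrancl_mono by blast
    next
      case False
      then obtain e where e: "e \<in> T" "e \<in> F" by blast
      have "F - insert e F' = F - F' - {e}" by blast
      moreover have "e \<in> F - F'" using e T(1) by blast
      ultimately have "card (F - insert e F') \<le> j + 1" using F(3) by simp
      then have "(s, t) \<in> (W e - F)\<^sup>*" using WF[OF e(1), rule_format, of F] F e by simp
      moreover have "W e - F \<subseteq> X - F" using e by (auto simp: X_def)
      ultimately show ?thesis using rtrancl_mono by blast
    qed
    moreover have "X \<subseteq> E" using W(1) T(1) by (auto simp: X_def)
    ultimately show ?thesis using cX by (intro exI[of _ X]) auto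
  next
    case False
    have "R \<inter> through (E - F) s t \<noteq> {}"
      if F: "F \<subseteq> E" "F' \<subseteq> F" "card (F - F') \<le> Suc j + 1" "(s, t) \<in> (E - F)\<^sup>*" for F
    proof
      assume empty: "R \<inter> through (E - F) s t = {}"
      have "F = F' \<union> (F - F')" using F(2) by blast
      then have "card F \<le> k" using card_Un_le[of F' "F - F'"] F(3) Suc.prems(2) by simp
      then have cL: "card (through (E - F) s t) \<le> L" using narrow F(1) empty by blast
      have "E - F \<subseteq> V \<times> V" using V by auto
      then obtain T where T: "T \<subseteq> E - F" "card T \<le> 2 ^ (0 + 1) * card (through (E - F) s t)"
        "\<And>D. finite D \<Longrightarrow> card D \<le> 0 \<Longrightarrow> (s, t) \<in> (E - F - D)\<^sup>* \<Longrightarrow> (s, t) \<in> (T - D)\<^sup>*"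
        using narrow_pair_preserver[OF V(1) _ V(3)] by metis
      have "(s, t) \<in> T\<^sup>*" using T(3)[of "{}"] F(4) by simp
      moreover have "T \<subseteq> E - F'" using T(1) F(2) by blast
      moreover have "card T \<le> 2 * L" using T(2) cL by simp
      ultimately show False using False by blast
    qed
    then show ?thesis by (intro exI[of _ "{}"]) auto
  qed
qed

text \<open>A nonempty set arises from a smaller one by inserting an arc. The crude bound is enough,
  since only its logarithm enters the size of the hitting set.\<close>

lemma card_small_subsets:
  assumes "finite E"
  shows "finite {F. F \<subseteq> E \<and> card F \<le> k} \<and> card {F. F \<subseteq> E \<and> card F \<le> k} \<le> (card E + 1) ^ k"
proof (induction k)
  case 0
  have "{F. F \<subseteq> E \<and> card F \<le> 0} = {{}}"
    using assms by (auto simp: card_eq_0_iff dest: finite_subset)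
  then show ?case by simp
next
  case (Suc k)
  define A where "A = {F. F \<subseteq> E \<and> card F \<le> k}"
  have A: "finite A" "card A \<le> (card E + 1) ^ k" using Suc by (auto simp: A_def)
  have "{F. F \<subseteq> E \<and> card F \<le> Suc k} \<subseteq> A \<union> (\<lambda>(e, F). insert e F) ` (E \<times> A)"
  proof
    fix F assume "F \<in> {F. F \<subseteq> E \<and> card F \<le> Suc k}"
    then have F: "F \<subseteq> E" "card F \<le> Suc k" by auto
    show "F \<in> A \<union> (\<lambda>(e, F). insert e F) ` (E \<times> A)"
    proof (cases "F = {}")
      case True
      then show ?thesis by (simp add: A_def)
    next
      case False
      then obtain e where e: "e \<in> F" by blast
      have "card (F - {e}) \<le> k" using e F by simp
      then have "(e, F - {e}) \<in> E \<times> A" using e F by (auto simp: A_def)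
      then show ?thesis using e by (auto intro!: image_eqI[of _ _ "(e, F - {e})"])
    qed
  qed
  note sub = this
  have fin: "finite (A \<union> (\<lambda>(e, F). insert e F) ` (E \<times> A))" using A assms by simp
  note card_mono[OF fin sub] finite_subset[OF sub fin]
  moreover have "card (A \<union> (\<lambda>(e, F). insert e F) ` (E \<times> A)) \<le> card A + card (E \<times> A)"
    using A assms card_image_le[of "E \<times> A" "\<lambda>(e, F). insert e F"]
    by (intro order_trans[OF card_Un_le]) auto
  moreover have "card A + card (E \<times> A) = (card E + 1) * card A" by (simp add: card_cartesian_product)
  moreover have "(card E + 1) * card A \<le> (card E + 1) ^ Suc k"
    unfolding power_Suc by (rule mult_le_mono2[OF A(2)])
  ultimately show ?case by linarith
qed

section \<open>Preservers for many pairs\<close>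

text \<open>The threshold \<open>c\<close> stays free, to be balanced later. The first summand is
  the size of the hitting set times two preservers of \<open>2 ^ (k + 1) * card V\<close> arcs per
  vertex in it; the second is the branching cost over all pairs.\<close>

theorem pairs_preserver:
  fixes c :: real
  assumes V: "finite V" "E \<subseteq> V \<times> V" and P: "P \<subseteq> V \<times> V"
    and k: "1 \<le> k" and n: "2 \<le> card V" and c: "1 \<le> c"
  shows "\<exists>H\<subseteq>E. real (card H) \<le>
      (card V / c * (5 * k * ln (card V)) + 1) * (4 * 2 ^ k * card V) + card P * (4 * c) ^ k \<and>
    (\<forall>(s, t)\<in>P. \<forall>F\<subseteq>E. card F \<le> k \<longrightarrow> ((s, t) \<in> (E - F)\<^sup>* \<longleftrightarrow> (s, t) \<in> (H - F)\<^sup>*))"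
proof -
  have fE: "finite E" and fP: "finite P" using V P finite_subset by (blast intro: finite_SigmaI)+
  \<comment> \<open>Vertex counts are integers: more than \<open>L\<close> vertices means at least
    \<open>L + 1\<close>, hence more than \<open>c\<close>.\<close>
  define L where "L = nat \<lfloor>c\<rfloor>"
  have L: "1 \<le> L" "real L \<le> c" "c < real L + 1" 
    using c unfolding L_def by linarith+
  define \<S> where "\<S> = {F. F \<subseteq> E \<and> card F \<le> k}"
  define f where "f q = through (E - fst q) (fst (snd q)) (snd (snd q))" for q
  define \<F> where "\<F> = {X \<in> f ` (\<S> \<times> P). L < card X}"
  have \<S>: "finite \<S>" "card \<S> \<le> (card E + 1) ^ k"
    using card_small_subsets[OF fE, of k] by (auto simp: \<S>_def)
  have "card \<F> \<le> card (f ` (\<S> \<times> P))"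
    by (rule card_mono) (use \<S> fP in \<open>auto simp: \<F>_def\<close>)
  also have "\<dots> \<le> card (\<S> \<times> P)" by (rule card_image_le) (use \<S> fP in simp)
  also have "\<dots> = card \<S> * card P" by (rule card_cartesian_product)
  \<comment> \<open>From two vertices on, \<open>card E + 1\<close> is at most
    \<open>card V ^ 3\<close>. This gives 3k + 2 \<le> 5k as exponent, the origin of
    \<open>5 * k\<close> in front of the logarithm.\<close>
  also have "\<dots> \<le> (card V ^ 3) ^ k * card V ^ 2"
  proof (rule mult_mono)
    have "card E \<le> card (V \<times> V)" using V by (intro card_mono) auto
    then have "card E \<le> card V ^ 2" by (simp add: card_cartesian_product power2_eq_square)
    moreover have "1 \<le> card V ^ 2" using n by (intro one_le_power) simp
    ultimately have "card E + 1 \<le> 2 * card V ^ 2" by linarith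
    also have "\<dots> \<le> card V * card V ^ 2" using n by (rule mult_le_mono1)
    also have "\<dots> = card V ^ 3" by (simp add: power2_eq_square power3_eq_cube)
    finally have "(card E + 1) ^ k \<le> (card V ^ 3) ^ k" by (rule power_mono) simp
    then show "card \<S> \<le> (card V ^ 3) ^ k" using \<S> by linarith
    have "card P \<le> card (V \<times> V)" using V P by (intro card_mono) auto
    then show "card P \<le> card V ^ 2" by (simp add: card_cartesian_product power2_eq_square)
  qed auto
  also have "\<dots> = card V ^ (3 * k + 2)" by (simp only: power_add power_mult)
  also have "\<dots> \<le> card V ^ (5 * k)" using n k by (intro power_increasing) auto
  finally have "card \<F> \<le> card V ^ (5 * k)" .
  then have cF: "real (card \<F>) \<le> real (card V) ^ (5 * k)"
    using of_nat_mono[of "card \<F>" "card V ^ (5 * k)", where 'a = real] by simp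
  have fF: "finite \<F>" using \<S> fP by (auto simp: \<F>_def)
  have F: "X \<subseteq> V \<and> c \<le> real (card X)" if XF: "X \<in> \<F>" for X
  proof -
    obtain q where X: "X = f q" "q \<in> \<S> \<times> P" "L < card X"
      using XF unfolding \<F>_def by blast
    have s: "fst (snd q) \<in> V" using X(2) P by auto
    have "x \<in> V" if "(fst (snd q), x) \<in> (E - fst q)\<^sup>*" for x
      using that s V(2) by (induction rule: rtrancl_induct) auto
    then have "X \<subseteq> V" by (auto simp: X(1) f_def through_def)
    moreover have "c \<le> real (card X)" using X(3) L(3) by linarith
    ultimately show ?thesis ..
  qed
  have "1 \<le> real (card V) ^ (5 * k)" "0 < card V" "0 < c" using n c by (auto intro: one_le_power)
  note N = this
  obtain R where R: "R \<subseteq> V" "real (card R) \<le> card V / c * ln (real (card V) ^ (5 * k)) + 1"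
    and hit: "\<And>X. X \<in> \<F> \<Longrightarrow> R \<inter> X \<noteq> {}"
    by (rule hitting_set[OF V(1) N(2,3) cF N(1) fF F]) (assumption, blast)
  have cR: "real (card R) \<le> card V / c * (5 * k * ln (card V)) + 1"
    using R(2) n by (simp add: ln_realpow)
  have fR: "finite R" using R(1) V(1) finite_subset by blast
  have "\<exists>K\<subseteq>E. card K \<le> 2 ^ (k + 1) * card V \<and>
    (\<forall>F x. finite F \<longrightarrow> card F \<le> k \<longrightarrow> (r, x) \<in> (E - F)\<^sup>* \<longrightarrow> (r, x) \<in> (K - F)\<^sup>*)" if "r \<in> R" for r
    using single_source_preserver[OF V, of r k] that R(1) by (metis subsetD)
  then obtain K1 where K1: "\<And>r. r \<in> R \<Longrightarrow> K1 r \<subseteq> E" "\<And>r. r \<in> R \<Longrightarrow> card (K1 r) \<le> 2 ^ (k + 1) * card V"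
    "\<And>r F x. r \<in> R \<Longrightarrow> finite F \<Longrightarrow> card F \<le> k \<Longrightarrow> (r, x) \<in> (E - F)\<^sup>* \<Longrightarrow> (r, x) \<in> (K1 r - F)\<^sup>*"
    by metis
  have "\<exists>K\<subseteq>E. card K \<le> 2 ^ (k + 1) * card V \<and>
    (\<forall>F x. finite F \<longrightarrow> card F \<le> k \<longrightarrow> (x, r) \<in> (E - F)\<^sup>* \<longrightarrow> (x, r) \<in> (K - F)\<^sup>*)" if "r \<in> R" for r
    using single_target_preserver[OF V, of r k] that R(1) by (metis subsetD)
  then obtain K2 where K2: "\<And>r. r \<in> R \<Longrightarrow> K2 r \<subseteq> E" "\<And>r. r \<in> R \<Longrightarrow> card (K2 r) \<le> 2 ^ (k + 1) * card V"
    "\<And>r F x. r \<in> R \<Longrightarrow> finite F \<Longrightarrow> card F \<le> k \<Longrightarrow> (x, r) \<in> (E - F)\<^sup>* \<Longrightarrow> (x, r) \<in> (K2 r - F)\<^sup>*"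
    by metis
  have "\<exists>W\<subseteq>E. card W \<le> (4 * L) ^ k \<and> (\<forall>F\<subseteq>E. card F \<le> k \<longrightarrow> (fst p, snd p) \<in> (E - F)\<^sup>* \<longrightarrow>
      R \<inter> through (E - F) (fst p) (snd p) = {} \<longrightarrow> (fst p, snd p) \<in> (W - F)\<^sup>*)" if p: "p \<in> P" for p
  proof -
    have st: "fst p \<in> V" "snd p \<in> V" using p P by auto
    have narrow: "card (through (E - F) (fst p) (snd p)) \<le> L"
      if "F \<subseteq> E" "card F \<le> k" "R \<inter> through (E - F) (fst p) (snd p) = {}" for F
    proof (rule ccontr)
      assume "\<not> ?thesis"
      moreover have "f (F, p) \<in> f ` (\<S> \<times> P)" using that p by (intro imageI) (simp add: \<S>_def)
      ultimately have "through (E - F) (fst p) (snd p) \<in> \<F>" by (simp add: \<F>_def f_def)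
      then show False using hit that(3) by blast
    qed
    \<comment> \<open>The branching starts without faults, at \<open>F' = {}\<close> and
      \<open>j = k - 1\<close>.\<close>
    have "\<exists>W\<subseteq>E. card W \<le> (4 * L) ^ (k - 1 + 1) \<and>
      (\<forall>F\<subseteq>E. {} \<subseteq> F \<longrightarrow> card (F - {}) \<le> k - 1 + 1 \<longrightarrow> (fst p, snd p) \<in> (E - F)\<^sup>* \<longrightarrow>
        R \<inter> through (E - F) (fst p) (snd p) = {} \<longrightarrow> (fst p, snd p) \<in> (W - F)\<^sup>*)"
      by (rule pair_preserver[where R = R, OF V st L(1) narrow]) (use k in auto)
    then show ?thesis using k by simp
  qed
  then obtain W where W: "\<And>p. p \<in> P \<Longrightarrow> W p \<subseteq> E" "\<And>p. p \<in> P \<Longrightarrow> card (W p) \<le> (4 * L) ^ k"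
    and WF: "\<And>p. p \<in> P \<Longrightarrow> \<forall>F\<subseteq>E. card F \<le> k \<longrightarrow> (fst p, snd p) \<in> (E - F)\<^sup>* \<longrightarrow>
      R \<inter> through (E - F) (fst p) (snd p) = {} \<longrightarrow> (fst p, snd p) \<in> (W p - F)\<^sup>*"
    by metis
  define H where "H = (\<Union>r\<in>R. K1 r \<union> K2 r) \<union> (\<Union>p\<in>P. W p)"
  have HE: "H \<subseteq> E" unfolding H_def by (intro Un_least UN_least K1(1) K2(1) W(1))
  have "card H \<le> card (\<Union>r\<in>R. K1 r \<union> K2 r) + card (\<Union>p\<in>P. W p)" unfolding H_def by (rule card_Un_le)
  also have "\<dots> \<le> (\<Sum>r\<in>R. card (K1 r \<union> K2 r)) + (\<Sum>p\<in>P. card (W p))"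
    by (intro add_mono card_UN_le fR fP)
  also have "\<dots> \<le> (\<Sum>r\<in>R. 4 * 2 ^ k * card V) + (\<Sum>p\<in>P. (4 * L) ^ k)"
  proof (intro add_mono sum_mono)
    fix r assume "r \<in> R"
    then show "card (K1 r \<union> K2 r) \<le> 4 * 2 ^ k * card V"
      using card_Un_le[of "K1 r" "K2 r"] K1(2)[of r] K2(2)[of r] by simp
  qed (rule W(2))
  finally have "card H \<le> card R * (4 * 2 ^ k * card V) + card P * (4 * L) ^ k" by simp
  then have "real (card H) \<le> real (card R * (4 * 2 ^ k * card V) + card P * (4 * L) ^ k)"
    by (rule of_nat_mono)
  also have "\<dots> = real (card R) * (4 * 2 ^ k * card V) + card P * (4 * real L) ^ k" by simp
  also have "\<dots> \<le> (card V / c * (5 * k * ln (card V)) + 1) * (4 * 2 ^ k * card V) + card P * (4 * c) ^ k"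
    using L by (intro add_mono mult_right_mono mult_left_mono power_mono cR) auto
  finally have cH: "real (card H) \<le>
    (card V / c * (5 * k * ln (card V)) + 1) * (4 * 2 ^ k * card V) + card P * (4 * c) ^ k" .
  have "(s, t) \<in> (E - F)\<^sup>* \<longleftrightarrow> (s, t) \<in> (H - F)\<^sup>*"
    if st: "(s, t) \<in> P" and F: "F \<subseteq> E" "card F \<le> k" for s t F
  proof
    assume "(s, t) \<in> (H - F)\<^sup>*"
    moreover have "(H - F)\<^sup>* \<subseteq> (E - F)\<^sup>*" using HE by (intro rtrancl_mono) blast
    ultimately show "(s, t) \<in> (E - F)\<^sup>*" by blast
  next
    assume reach: "(s, t) \<in> (E - F)\<^sup>*"
    have fF: "finite F" using F(1) fE finite_subset by blast
    show "(s, t) \<in> (H - F)\<^sup>*"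
    proof (cases "R \<inter> through (E - F) s t = {}")
      case True
      then have "(s, t) \<in> (W (s, t) - F)\<^sup>*" using WF[OF st] F reach by simp
      moreover have "(W (s, t) - F)\<^sup>* \<subseteq> (H - F)\<^sup>*"
        using st by (intro rtrancl_mono) (auto simp: H_def)
      ultimately show ?thesis by blast
    next
      case False
      then obtain r where r: "r \<in> R" "(s, r) \<in> (E - F)\<^sup>*" "(r, t) \<in> (E - F)\<^sup>*"
        by (auto simp: through_def)
      have "(s, r) \<in> (K2 r - F)\<^sup>*" using K2(3) r fF F by blast
      moreover have "(r, t) \<in> (K1 r - F)\<^sup>*" using K1(3) r fF F by blast
      moreover have "(K1 r - F)\<^sup>* \<subseteq> (H - F)\<^sup>*" "(K2 r - F)\<^sup>* \<subseteq> (H - F)\<^sup>*"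
        using r(1) by (intro rtrancl_mono; auto simp: H_def)+
      ultimately show ?thesis by (meson rtrancl_trans subsetD)
    qed
  qed
  then show ?thesis using HE cH by (intro exI[of _ H]) auto
qed

text \<open>The choice of \<open>c\<close> turns the branching cost \<open>(4 * c) ^ k\<close> into
  \<epsilon>^k n \<le> \<epsilon> n, which is at most half of the allowance per pair because 2 \<le>
  2^k. The hitting set has at most (24 / \<epsilon>) M vertices, at
  \<open>4 * 2 ^ k * card V\<close> arcs each; 192 = 2 * 4 * 24 brings this below the other
  half.\<close>

lemma sparse_pairs_preserver:
  fixes \<epsilon> :: real
  assumes V: "finite V" "E \<subseteq> V \<times> V" and P: "P \<subseteq> V \<times> V"
    and k: "1 \<le> k" and n: "3 \<le> card V" and \<epsilon>: "0 < \<epsilon>" "\<epsilon> \<le> 1"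
    and many: "192 / \<epsilon>\<^sup>2 * (k * card V powr (1 - 1 / k) * ln (card V)) \<le> card P"
  shows "\<exists>H\<subseteq>E. real (card H) \<le> \<epsilon> * (2 ^ k * card V * card P) \<and>
    (\<forall>(s, t)\<in>P. \<forall>F\<subseteq>E. card F \<le> k \<longrightarrow> ((s, t) \<in> (E - F)\<^sup>* \<longleftrightarrow> (s, t) \<in> (H - F)\<^sup>*))"
proof -
  define N where "N = real (card V)"
  define p where "p = real (card P)"
  define M where "M = k * N powr (1 - 1 / k) * ln N"
  define c where "c = \<epsilon> / 4 * N powr (1 / k)"
  have N: "3 \<le> N" using n by (simp add: N_def)
  have p: "0 \<le> p" by (simp add: p_def)
  have M: "M \<le> \<epsilon>\<^sup>2 / 192 * p" using many \<epsilon> by (simp add: M_def N_def p_def field_simps)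
  have "exp 1 \<le> N" using N exp_le by linarith
  \<comment> \<open>Three vertices are more than e, so the logarithm is at least 1 and
    \<open>M\<close> dominates the bare power of \<open>N\<close>.\<close>
  then have ln: "1 \<le> ln N" using N by (simp add: ln_ge_iff)
  have "1 * 1 \<le> real k * ln N" using k ln by (intro mult_mono) auto
  then have kln: "1 \<le> real k * ln N" by simp
  have "1 * N powr (1 - 1 / k) \<le> (real k * ln N) * N powr (1 - 1 / k)"
    by (rule mult_right_mono[OF kln]) simp
  then have powM: "N powr (1 - 1 / k) \<le> M" by (simp add: M_def mult_ac)
  have split: "N powr (1 - 1 / k) * N powr (1 / k) = N" using N by (simp add: powr_add[symmetric])
  have k2: "2 \<le> (2 :: real) ^ k" using power_increasing[of 1 k "2 :: real"] k by simp
  show ?thesis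
  proof (cases "1 \<le> c")
    case False
    have "card E \<le> card (V \<times> V)" using V by (intro card_mono) auto
    then have "card E \<le> card V * card V" by (simp add: card_cartesian_product)
    then have "real (card E) \<le> N * N" unfolding N_def by (metis of_nat_le_iff of_nat_mult)
    also have "N \<le> \<epsilon> * p"
    proof -
      have "N powr (1 / k) \<le> 4 / \<epsilon>" using False \<epsilon> by (simp add: c_def field_simps)
      then have "N powr (1 - 1 / k) * N powr (1 / k) \<le> (\<epsilon>\<^sup>2 / 192 * p) * (4 / \<epsilon>)"
        using powM M p by (intro mult_mono) auto
      also have "\<dots> = \<epsilon> * p / 48" using \<epsilon> by (simp add: power2_eq_square)
      also have "\<dots> \<le> \<epsilon> * p" using \<epsilon> p by simp
      finally show ?thesis unfolding split .
    qed
    then have "N * N \<le> N * (\<epsilon> * p)" using N by (intro mult_left_mono) auto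
    also have "\<dots> \<le> 2 ^ k * (N * (\<epsilon> * p))"
      using mult_right_mono[of 1 "2 ^ k" "N * (\<epsilon> * p)"] k2 N \<epsilon> p by simp
    finally have "real (card E) \<le> \<epsilon> * (2 ^ k * card V * card P)"
      by (simp add: N_def p_def mult_ac)
    then show ?thesis by (intro exI[of _ E]) auto
  next
    case True
    obtain H where H: "H \<subseteq> E" "real (card H) \<le>
      (card V / c * (5 * k * ln (card V)) + 1) * (4 * 2 ^ k * card V) + card P * (4 * c) ^ k"
      "\<forall>(s, t)\<in>P. \<forall>F\<subseteq>E. card F \<le> k \<longrightarrow> ((s, t) \<in> (E - F)\<^sup>* \<longleftrightarrow> (s, t) \<in> (H - F)\<^sup>*)"
      using pairs_preserver[OF V P k _ True] n by auto
    have c0: "0 < c" using True by simp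
    have "N / c = 4 / \<epsilon> * N powr (1 - 1 / k)"
      using split \<epsilon> c0 N by (simp add: c_def field_simps)
    then have "N / c * (5 * k * ln N) = 20 / \<epsilon> * M" by (simp add: M_def)
    moreover have "1 \<le> 4 / \<epsilon> * M"
    proof -
      have "1 \<le> N powr (1 - 1 / k)" using N k by (intro ge_one_powr_ge_zero) auto
      then have "1 * 1 \<le> 4 / \<epsilon> * M" using powM \<epsilon> by (intro mult_mono) auto
      then show ?thesis by simp
    qed
    ultimately have "N / c * (5 * k * ln N) + 1 \<le> 24 / \<epsilon> * M" using \<epsilon> by (simp add: field_simps)
    also have "\<dots> \<le> 24 / \<epsilon> * (\<epsilon>\<^sup>2 / 192 * p)" using M \<epsilon> by (intro mult_left_mono) auto
    also have "\<dots> = \<epsilon> / 8 * p" using \<epsilon> by (simp add: power2_eq_square)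
    finally have "(N / c * (5 * k * ln N) + 1) * (4 * 2 ^ k * N) \<le> \<epsilon> / 8 * p * (4 * 2 ^ k * N)"
      using N by (intro mult_right_mono) auto
    moreover have "p * (4 * c) ^ k \<le> p * (\<epsilon> * N)"
    proof (intro mult_left_mono p)
      have "(N powr (1 / k)) ^ k = N"
        using N k by (simp add: powr_realpow[symmetric] powr_powr)
      then have "(4 * c) ^ k = \<epsilon> ^ k * N" by (simp add: c_def power_mult_distrib)
      also have "\<dots> \<le> \<epsilon> ^ 1 * N"
        using N \<epsilon> k by (intro mult_right_mono power_decreasing) auto
      finally show "(4 * c) ^ k \<le> \<epsilon> * N" by simp
    qed
    moreover have "2 * (p * (\<epsilon> * N)) \<le> 2 ^ k * (p * (\<epsilon> * N))"
      using k2 p N \<epsilon> by (intro mult_right_mono) auto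
    moreover have "\<epsilon> / 8 * p * (4 * 2 ^ k * N) = 2 ^ k * (p * (\<epsilon> * N)) / 2" by simp
    ultimately have "(N / c * (5 * k * ln N) + 1) * (4 * 2 ^ k * N) + p * (4 * c) ^ k \<le> 2 ^ k * (p * (\<epsilon> * N))"
      by linarith
    also have "\<dots> = \<epsilon> * (2 ^ k * N * p)" by simp
    finally have "(N / c * (5 * k * ln N) + 1) * (4 * 2 ^ k * N) + p * (4 * c) ^ k \<le> \<epsilon> * (2 ^ k * N * p)" .
    then show ?thesis using H by (intro exI[of _ H]) (auto simp: N_def p_def)
  qed
qed

section \<open>Transfer to library digraphs\<close>

lemma reachable_with_proj_iff:
  assumes "parcs G \<subseteq> pverts G \<times> pverts G" "s \<in> pverts G"
  shows "s \<rightarrow>\<^sup>*\<^bsub>with_proj G\<^esub> t \<longleftrightarrow> (s, t) \<in> (parcs G)\<^sup>*"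
proof
  assume "s \<rightarrow>\<^sup>*\<^bsub>with_proj G\<^esub> t"
  then show "(s, t) \<in> (parcs G)\<^sup>*" using reachable_rtranclI by fastforce
next
  assume "(s, t) \<in> (parcs G)\<^sup>*"
  then have "(s, t) \<in> rtrancl_on (pverts G) (parcs G)"
    using assms by (induction rule: rtrancl_induct) (auto intro: rtrancl_on_into_rtrancl_on)
  then show "s \<rightarrow>\<^sup>*\<^bsub>with_proj G\<^esub> t" by (simp add: reachable_def)
qed

text \<open>The subgraph keeps all vertices of \<open>G\<close>. Since arcs stay inside the vertex
  set and sources are vertices, library reachability then agrees with the reflexive transitive
  closure on both sides, also for the trivial walk.\<close>

lemma ft_reachability_subgraphI:
  assumes G: "pair_wf_digraph G" and P: "P \<subseteq> pverts G \<times> pverts G" and H: "H \<subseteq> parcs G"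
    and pres: "\<forall>(s, t)\<in>P. \<forall>F\<subseteq>parcs G. card F \<le> k \<longrightarrow>
      ((s, t) \<in> (parcs G - F)\<^sup>* \<longleftrightarrow> (s, t) \<in> (H - F)\<^sup>*)"
  shows "ft_reachability_subgraph k G P \<lparr> pverts = pverts G, parcs = H \<rparr>"
proof -
  let ?H = "\<lparr> pverts = pverts G, parcs = H \<rparr>"
  have GV: "parcs G \<subseteq> pverts G \<times> pverts G"
    using G unfolding pair_wf_digraph_def by auto
  have "pair_wf_digraph ?H" using GV H by unfold_locales auto
  then have "subgraph (with_proj ?H) (with_proj G)"
    unfolding subgraph_def using G H by (auto simp: wf_digraph_wp_iff compatible_def)
  moreover have "s \<rightarrow>\<^sup>*\<^bsub>with_proj (delete_arcs G F)\<^esub> t \<longleftrightarrow> s \<rightarrow>\<^sup>*\<^bsub>with_proj (delete_arcs ?H F)\<^esub> t"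
    if st: "(s, t) \<in> P" and F: "F \<subseteq> parcs G" "card F \<le> k" for s t F
  proof -
    have "s \<in> pverts G" using st P by auto
    then have "s \<rightarrow>\<^sup>*\<^bsub>with_proj (delete_arcs G F)\<^esub> t \<longleftrightarrow> (s, t) \<in> (parcs G - F)\<^sup>*"
      "s \<rightarrow>\<^sup>*\<^bsub>with_proj (delete_arcs ?H F)\<^esub> t \<longleftrightarrow> (s, t) \<in> (H - F)\<^sup>*"
      using GV H by (subst reachable_with_proj_iff; auto simp: delete_arcs_def)+
    then show ?thesis using pres st F by auto
  qed
  ultimately show ?thesis unfolding ft_reachability_subgraph_def by auto
qed

text \<open>Graph, pairs and \<open>k\<close> may all vary along the filter, so the constants hidden
  in the asymptotic bounds are independent of \<open>k\<close>.\<close>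

theorem theorem1p7:
  fixes A :: "'i filter"
    and k :: "'i \<Rightarrow> nat"
    and G :: "'i \<Rightarrow> 'a pair_pre_digraph"
    and P :: "'i \<Rightarrow> ('a \<times> 'a) set"
    and n :: "'i \<Rightarrow> nat"
  assumes "\<And>i. k i \<ge> 1"
    and "\<And>i. pair_fin_digraph (G i)"
    and "\<And>i. n i = card (pverts (G i))"
    and "filterlim n at_top A"
    and "\<And>i. P i \<subseteq> pverts (G i) \<times> pverts (G i)"
    and "(\<lambda>i. real (card (P i))) \<in>
           \<omega>[A](\<lambda>i. real (k i) * real (n i) powr (1 - 1 / real (k i)) * ln (real (n i)))"
  shows "\<exists>H. (\<forall>i. ft_reachability_subgraph (k i) (G i) (P i) (H i)) \<and>
           (\<lambda>i. real (card (parcs (H i)))) \<in>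
             o[A](\<lambda>i. 2 ^ k i * real (n i) * real (card (P i)))"
proof -
  define Q where "Q i H \<longleftrightarrow> H \<subseteq> parcs (G i) \<and> (\<forall>(s, t)\<in>P i. \<forall>F\<subseteq>parcs (G i). card F \<le> k i \<longrightarrow>
      ((s, t) \<in> (parcs (G i) - F)\<^sup>* \<longleftrightarrow> (s, t) \<in> (H - F)\<^sup>*))" for i H
  have wf: "pair_wf_digraph (G i)" for i using assms(2) by (simp add: pair_fin_digraph_def)
  have fin: "finite (pverts (G i))" for i
    using assms(2)[of i] by (simp add: pair_fin_digraph_def pair_fin_digraph_axioms_def)
  have GV: "parcs (G i) \<subseteq> pverts (G i) \<times> pverts (G i)" for i
    using wf[of i] unfolding pair_wf_digraph_def by auto
  \<comment> \<open>A smallest preserver serves all constants of the \<open>o\<close> bound at once.\<close>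
  have "\<exists>H. Q i H \<and> (\<forall>K. Q i K \<longrightarrow> card H \<le> card K)" for i
  proof -
    have "Q i (parcs (G i))" by (auto simp: Q_def)
    then show ?thesis by (rule ex_has_least_nat)
  qed
  then obtain H where H: "\<And>i. Q i (H i)" and H_least: "\<And>i K. Q i K \<Longrightarrow> card (H i) \<le> card K"
    by metis
  have "ft_reachability_subgraph (k i) (G i) (P i) \<lparr> pverts = pverts (G i), parcs = H i \<rparr>" for i
    using H[of i] unfolding Q_def by (intro ft_reachability_subgraphI wf assms(5)) auto
  moreover have "(\<lambda>i. real (card (H i))) \<in> o[A](\<lambda>i. 2 ^ k i * real (n i) * real (card (P i)))"
  proof (rule landau_o.smallI)
    fix \<delta> :: real assume \<delta>: "0 < \<delta>"
    \<comment> \<open>The quantitative bound is available only for \<epsilon> \<le> 1; a smaller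
      constant serves \<delta> as well.\<close>
    define \<epsilon> where "\<epsilon> = min \<delta> 1"
    have \<epsilon>: "0 < \<epsilon>" "\<epsilon> \<le> 1" "\<epsilon> \<le> \<delta>" using \<delta> by (auto simp: \<epsilon>_def)
    then have "0 < 192 / \<epsilon>\<^sup>2" by simp
    from landau_omega.smallD[OF assms(6) this]
    have "\<forall>\<^sub>F i in A. 192 / \<epsilon>\<^sup>2 * norm (real (k i) * real (n i) powr (1 - 1 / real (k i)) * ln (real (n i)))
      \<le> norm (real (card (P i)))" .
    moreover have "\<forall>\<^sub>F i in A. 3 \<le> n i" using assms(4) by (simp add: filterlim_at_top)
    ultimately show "\<forall>\<^sub>F i in A. norm (real (card (H i))) \<le> \<delta> * norm (2 ^ k i * real (n i) * real (card (P i)))"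
    proof eventually_elim
      case (elim i)
      have "192 / \<epsilon>\<^sup>2 * (k i * n i powr (1 - 1 / k i) * ln (n i)) \<le> card (P i)"
        using elim by (simp add: abs_mult)
      then obtain K where K: "Q i K" "real (card K) \<le> \<epsilon> * (2 ^ k i * n i * card (P i))"
        using sparse_pairs_preserver[OF fin GV assms(5,1) _ \<epsilon>(1,2), of i] elim(2)
        unfolding Q_def assms(3) by blast
      have "real (card (H i)) \<le> real (card K)" using H_least[OF K(1)] by simp
      also note K(2)
      also have "\<epsilon> * (2 ^ k i * n i * card (P i)) \<le> \<delta> * (2 ^ k i * n i * card (P i))"
        using \<epsilon>(3) by (rule mult_right_mono) simp
      finally show ?case by simp
    qed
  qed
  ultimately show ?thesis
    by (intro exI[of _ "\<lambda>i. \<lparr> pverts = pverts (G i), parcs = H i \<rparr>"]) simp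
qed

end
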